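(* Let $n \geq 3$ be an integer. Then all of the following hold. (1) There exist irreducible hypersurfaces $H_1, H_2 \subset \mathbb{C}^n$ with isomorphic complements $\mathbb{C}^n \setminus H_1 \simeq \mathbb{C}^n \setminus H_2$ such that $H_1$ and $H_2$ are both smooth and $H_1$ and $H_2$ are not isomorphic. (2) There exist irreducible hypersurfaces $H_1, H_2 \subset \mathbb{C}^n$ with isomorphic complements $\mathbb{C}^n \setminus H_1 \simeq \mathbb{C}^n \setminus H_2$ such that $H_1$ is smooth but $H_2$ is singular. (3) There exist irreducible hypersurfaces $H_1, H_2 \subset \mathbb{C}^n$ with isomorphic complements $\mathbb{C}^n \setminus H_1 \simeq \mathbb{C}^n \setminus H_2$ such that $H_1$ and $H_2$ are isomorphic, although there is no automorphism of $\mathbb{C}^n$ mapping $H_1$ onto $H_2$.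
   Context: Everything is in the setting of algebraic geometry over $\mathbb{C}$. A hypersurface of $\mathbb{C}^n$ is an algebraic one, i.e. the zero set of a (nonconstant) polynomial in $\mathbb{C}[x_1,\ldots,x_n]$. Isomorphisms (denoted $\simeq$) are isomorphisms of complex algebraic varieties, and automorphisms of $\mathbb{C}^n$ are algebraic (polynomial) automorphisms. The complement of a hypersurface in $\mathbb{C}^n$ is regarded as an (affine) algebraic variety. *)

theory Defs
  imports "HOL-Analysis.Analysis" "HOL-Library.Poly_Mapping"
begin

text \<open>
  Affine \<open>n\<close>-space over the complex numbers is \<^typ>\<open>complex ^ 'n\<close> with \<open>n = CARD('n)\<close>. A polynomial in
  the variables indexed by \<^typ>\<open>'n\<close> is a finitely supported map from exponent vectors to
  coefficients.
\<close>

type_synonym 'n cpoly = "('n \<Rightarrow>\<^sub>0 nat) \<Rightarrow>\<^sub>0 complex"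

definition poly_eval :: "'n::finite cpoly \<Rightarrow> complex ^ 'n \<Rightarrow> complex" where
  "poly_eval p x =
     (\<Sum>m\<in>Poly_Mapping.keys p. Poly_Mapping.lookup p m * (\<Prod>i\<in>UNIV. (x $ i) ^ Poly_Mapping.lookup m i))"

text \<open>
  If the exponent of the variable \<open>i\<close> in \<open>m\<close> is zero, then \<open>m - single i 1\<close> is \<open>m\<close> (subtraction
  is truncated), but the corresponding coefficient vanishes.
\<close>

definition partial_deriv :: "'n \<Rightarrow> 'n cpoly \<Rightarrow> 'n cpoly" where
  "partial_deriv i p =
     (\<Sum>m\<in>Poly_Mapping.keys p.
        Poly_Mapping.single (m - Poly_Mapping.single i 1)
          (of_nat (Poly_Mapping.lookup m i) * Poly_Mapping.lookup p m))"

definition nonconstant :: "'n cpoly \<Rightarrow> bool" where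
  "nonconstant p \<longleftrightarrow> (\<exists>m\<in>Poly_Mapping.keys p. m \<noteq> 0)"

definition zariski_closed :: "(complex ^ 'n::finite) set \<Rightarrow> bool" where
  "zariski_closed X \<longleftrightarrow> (\<exists>P. X = {x. \<forall>p\<in>P. poly_eval p x = 0})"

definition zariski_open :: "(complex ^ 'n::finite) set \<Rightarrow> bool" where
  "zariski_open U \<longleftrightarrow> zariski_closed (- U)"

text \<open>Irreducibility with respect to the subspace topology induced by the Zariski topology.\<close>

definition zariski_irreducible :: "(complex ^ 'n::finite) set \<Rightarrow> bool" where
  "zariski_irreducible X \<longleftrightarrow> X \<noteq> {} \<and>
     (\<forall>A B. zariski_closed A \<longrightarrow> zariski_closed B \<longrightarrow> X \<subseteq> A \<union> B \<longrightarrow> X \<subseteq> A \<or> X \<subseteq> B)"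

definition hypersurface :: "(complex ^ 'n::finite) set \<Rightarrow> bool" where
  "hypersurface H \<longleftrightarrow> (\<exists>p. nonconstant p \<and> H = {x. poly_eval p x = 0})"

definition irreducible_hypersurface :: "(complex ^ 'n::finite) set \<Rightarrow> bool" where
  "irreducible_hypersurface H \<longleftrightarrow> hypersurface H \<and> zariski_irreducible H"

text \<open>
  Regular functions and regular maps on a locally closed subset of affine space; this covers both
  hypersurfaces and their complements. A function is regular on \<open>X\<close> if locally, in the Zariski
  topology of \<open>X\<close>, it is a quotient of polynomials. Values outside \<open>X\<close> are irrelevant.
\<close>

definition regular_on :: "(complex ^ 'n::finite) set \<Rightarrow> (complex ^ 'n \<Rightarrow> complex) \<Rightarrow> bool" where
  "regular_on X f \<longleftrightarrow>
     (\<forall>a\<in>X. \<exists>U g h. zariski_open U \<and> a \<in> U \<and>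
        (\<forall>x\<in>X \<inter> U. poly_eval h x \<noteq> 0 \<and> f x = poly_eval g x / poly_eval h x))"

definition regular_map ::
    "(complex ^ 'n::finite) set \<Rightarrow> (complex ^ 'm::finite) set \<Rightarrow> (complex ^ 'n \<Rightarrow> complex ^ 'm) \<Rightarrow> bool" where
  "regular_map X Y \<phi> \<longleftrightarrow> \<phi> ` X \<subseteq> Y \<and> (\<forall>j. regular_on X (\<lambda>x. \<phi> x $ j))"

definition variety_iso ::
    "(complex ^ 'n::finite) set \<Rightarrow> (complex ^ 'm::finite) set \<Rightarrow> bool" where
  "variety_iso X Y \<longleftrightarrow>
     (\<exists>\<phi> \<psi>. regular_map X Y \<phi> \<and> regular_map Y X \<psi> \<and>
        (\<forall>x\<in>X. \<psi> (\<phi> x) = x) \<and> (\<forall>y\<in>Y. \<phi> (\<psi> y) = y))"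

text \<open>
  The Zariski tangent space is cut out by the differentials of \<^emph>\<open>all\<close> polynomials vanishing on \<open>X\<close>,
  so it depends only on the (reduced) variety and not on a choice of equations.
\<close>

definition vanishing_ideal :: "(complex ^ 'n::finite) set \<Rightarrow> 'n cpoly set" where
  "vanishing_ideal X = {p. \<forall>x\<in>X. poly_eval p x = 0}"

definition tangent_space :: "(complex ^ 'n::finite) set \<Rightarrow> complex ^ 'n \<Rightarrow> (complex ^ 'n) set" where
  "tangent_space X a =
     {v. \<forall>p\<in>vanishing_ideal X. (\<Sum>i\<in>UNIV. poly_eval (partial_deriv i p) a * v $ i) = 0}"

text \<open>
  A point is smooth if the complex dimension of the tangent space equals the local dimension of the
  variety. Every hypersurface has dimension \<open>n - 1\<close> at each of its points.
\<close>

definition smooth_hypersurface :: "(complex ^ 'n::finite) set \<Rightarrow> bool" where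
  "smooth_hypersurface H \<longleftrightarrow> hypersurface H \<and>
     (\<forall>a\<in>H. vec.dim (tangent_space H a) = CARD('n) - 1)"

definition singular_hypersurface :: "(complex ^ 'n::finite) set \<Rightarrow> bool" where
  "singular_hypersurface H \<longleftrightarrow> hypersurface H \<and>
     (\<exists>a\<in>H. vec.dim (tangent_space H a) \<noteq> CARD('n) - 1)"

definition polynomial_map :: "(complex ^ 'n::finite \<Rightarrow> complex ^ 'm::finite) \<Rightarrow> bool" where
  "polynomial_map F \<longleftrightarrow> (\<forall>j. \<exists>p. \<forall>x. F x $ j = poly_eval p x)"

definition polynomial_automorphism :: "(complex ^ 'n::finite \<Rightarrow> complex ^ 'n) \<Rightarrow> bool" where
  "polynomial_automorphism F \<longleftrightarrow> polynomial_map F \<and>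
     (\<exists>G. polynomial_map G \<and> (\<forall>x. G (F x) = x) \<and> (\<forall>x. F (G x) = x))"

end

theory Submission
  imports Defs "HOL-Computational_Algebra.Fundamental_Theorem_Algebra"
begin

text \<open>
  For one-variable polynomials \<open>f, g\<close> put \<open>P\<^sub>k = g(z) x\<^sup>2 y + f(z) + x g(z) f(z)\<^sup>k\<close>. On the level
  \<open>P\<^sub>k = c\<close> one may replace \<open>f(z)\<^sup>k\<close> by \<open>c\<^sup>k\<close> at the price of a polynomial change of \<open>y\<close>, because \<open>f(z) - c\<close> is
  divisible by \<open>x g(z)\<close> there; for \<open>c \<noteq> 0\<close> the scaling \<open>x \<mapsto> x / c\<close>, \<open>y \<mapsto> c\<^sup>2 y\<close> then raises \<open>k\<close> by one.
  So the complements of the \<open>H\<^sub>k = {P\<^sub>k = 0}\<close> are all isomorphic, and the \<open>H\<^sub>k\<close>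
  themselves for \<open>k > 0\<close> are isomorphic to each other.

  With \<open>f = z\<^sup>2, g = 1\<close> the hypersurface \<open>H\<^sub>0\<close> is smooth and \<open>H\<^sub>1\<close> is singular. With \<open>f = z - 1, g = z\<close> all
  \<open>H\<^sub>k\<close> are smooth and \<open>z\<close> is, up to powers and constants, the only unit on them. Its differential vanishes
  somewhere on \<open>H\<^sub>1\<close> and nowhere on \<open>H\<^sub>0\<close>, so these are not isomorphic. Finally, an automorphism
  mapping \<open>H\<^sub>1\<close> onto \<open>H\<^sub>2\<close> would preserve the \<open>P\<^sub>k\<close> up to a constant and \<open>z\<close> up to a function of
  \<open>P\<^sub>1\<close> and inversion, hence the ideal generated by the coefficients of \<open>dP\<^sub>k \<and> dz\<close>; this ideal contains
  \<open>P\<^sub>k\<^sup>2\<close> for \<open>k = 1\<close> but not for \<open>k = 2\<close>. The remaining coordinates are passive.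
\<close>


section \<open>Polynomial functions\<close>

text \<open>Generated inductively, so that substitution, division and closure properties go by rule
  induction instead of coefficient computations. These are exactly the functions
  \<open>poly_eval p\<close>.\<close>

inductive polyfun :: "(complex ^ 'n::finite \<Rightarrow> complex) \<Rightarrow> bool" where
  const: "polyfun (\<lambda>v. c)"
| coord: "polyfun (\<lambda>v. v $ i)"
| add: "polyfun F \<Longrightarrow> polyfun G \<Longrightarrow> polyfun (\<lambda>v. F v + G v)"
| mult: "polyfun F \<Longrightarrow> polyfun G \<Longrightarrow> polyfun (\<lambda>v. F v * G v)"

lemma polyfun_uminus: "polyfun F \<Longrightarrow> polyfun (\<lambda>v. - F v)"
  using polyfun.mult[OF polyfun.const[of "-1"], of F] by simp

lemma polyfun_diff: "polyfun F \<Longrightarrow> polyfun G \<Longrightarrow> polyfun (\<lambda>v. F v - G v)"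
  using polyfun.add[OF _ polyfun_uminus, of F G] by simp

lemma polyfun_power: "polyfun F \<Longrightarrow> polyfun (\<lambda>v. F v ^ k)"
  by (induction k) (auto intro: polyfun.const polyfun.mult)

lemma polyfun_sum: "(\<And>i. i \<in> I \<Longrightarrow> polyfun (F i)) \<Longrightarrow> polyfun (\<lambda>v. \<Sum>i\<in>I. F i v)"
  by (induction I rule: infinite_finite_induct) (auto intro: polyfun.const polyfun.add)

lemma polyfun_prod: "(\<And>i. i \<in> I \<Longrightarrow> polyfun (F i)) \<Longrightarrow> polyfun (\<lambda>v. \<Prod>i\<in>I. F i v)"
  by (induction I rule: infinite_finite_induct) (auto intro: polyfun.const polyfun.mult)

lemma polyfun_poly: "polyfun F \<Longrightarrow> polyfun (\<lambda>v. poly p (F v))"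
  by (induction p) (auto intro: polyfun.const polyfun.mult polyfun.add)

lemmas polyfun_intros = polyfun.intros polyfun_uminus polyfun_diff polyfun_power polyfun_sum
  polyfun_prod polyfun_poly

section \<open>Evaluation as a ring homomorphism, and its image\<close>

lemma poly_eval_superset:
  assumes "finite A" "Poly_Mapping.keys p \<subseteq> A"
  shows "poly_eval p x =
    (\<Sum>m\<in>A. Poly_Mapping.lookup p m * (\<Prod>i\<in>UNIV. (x $ i) ^ Poly_Mapping.lookup m i))"
  unfolding poly_eval_def
  using assms by (intro sum.mono_neutral_left) (auto simp: in_keys_iff)

lemma poly_eval_add: "poly_eval (p + q) x = poly_eval p x + poly_eval q x"
proof -
  let ?A = "Poly_Mapping.keys p \<union> Poly_Mapping.keys q"
  have "poly_eval r x = (\<Sum>m\<in>?A. Poly_Mapping.lookup r m * (\<Prod>i\<in>UNIV. (x $ i) ^ Poly_Mapping.lookup m i))"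
    if "r \<in> {p, q, p + q}" for r
    using that Poly_Mapping.keys_add[of p q] by (intro poly_eval_superset) auto
  then show ?thesis
    by (simp add: lookup_add distrib_right sum.distrib)
qed

lemma poly_eval_0 [simp]: "poly_eval 0 x = 0"
  by (simp add: poly_eval_def)

lemma poly_eval_single:
  "poly_eval (Poly_Mapping.single m c) x = c * (\<Prod>i\<in>UNIV. (x $ i) ^ Poly_Mapping.lookup m i)"
  by (simp add: poly_eval_def)

lemma poly_eval_sum: "poly_eval (\<Sum>i\<in>I. p i) x = (\<Sum>i\<in>I. poly_eval (p i) x)"
  by (induction I rule: infinite_finite_induct) (auto simp: poly_eval_add)

lemma cpoly_expand:
  "(p :: 'n cpoly) = (\<Sum>m\<in>Poly_Mapping.keys p. Poly_Mapping.single m (Poly_Mapping.lookup p m))"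
proof (rule poly_mapping_eqI)
  fix k
  show "Poly_Mapping.lookup p k = Poly_Mapping.lookup
    (\<Sum>m\<in>Poly_Mapping.keys p. Poly_Mapping.single m (Poly_Mapping.lookup p m)) k"
    by (auto simp: lookup_sum lookup_single when_def in_keys_iff)
qed

lemma poly_eval_mult: "poly_eval (p * q) x = poly_eval p x * poly_eval q x"
proof -
  let ?s = "\<lambda>p m. Poly_Mapping.single m (Poly_Mapping.lookup p m)"
  have "p * q = (\<Sum>m\<in>Poly_Mapping.keys p. ?s p m) * (\<Sum>m\<in>Poly_Mapping.keys q. ?s q m)"
    using cpoly_expand[of p] cpoly_expand[of q] by simp
  also have "\<dots> = (\<Sum>m\<in>Poly_Mapping.keys p. \<Sum>l\<in>Poly_Mapping.keys q. ?s p m * ?s q l)"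
    by (simp add: sum_product)
  finally have "poly_eval (p * q) x =
    (\<Sum>m\<in>Poly_Mapping.keys p. \<Sum>l\<in>Poly_Mapping.keys q. poly_eval (?s p m * ?s q l) x)"
    by (simp add: poly_eval_sum)
  also have "\<dots> = poly_eval p x * poly_eval q x"
    unfolding poly_eval_def[of p] poly_eval_def[of q] sum_product
    by (intro sum.cong refl)
      (simp add: mult_single poly_eval_single lookup_add power_add prod.distrib mult_ac)
  finally show ?thesis .
qed

lemma polyfun_poly_eval: "polyfun (poly_eval p)"
  unfolding poly_eval_def by (intro polyfun_intros)

lemma polyfun_imp_poly_eval:
  assumes "polyfun F"
  shows "\<exists>p. \<forall>x. F x = poly_eval p x"
  using assms
proof induction
  case (const c)
  show ?case by (rule exI[of _ "Poly_Mapping.single 0 c"]) (simp add: poly_eval_single)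
next
  case (coord i)
  have "x $ i = poly_eval (Poly_Mapping.single (Poly_Mapping.single i 1) 1) x" for x :: "complex ^ 'a"
  proof -
    have "(\<Prod>j\<in>UNIV. (x $ j) ^ Poly_Mapping.lookup (Poly_Mapping.single i 1) j) =
        (\<Prod>j\<in>UNIV. if j = i then x $ j else 1)"
      by (intro prod.cong refl) (simp add: lookup_single when_def)
    then show ?thesis by (simp add: poly_eval_single)
  qed
  then show ?case by blast
next
  case (add F G)
  then show ?case by (metis poly_eval_add)
next
  case (mult F G)
  then show ?case by (metis poly_eval_mult)
qed

lemma continuous_polyfun: "polyfun F \<Longrightarrow> continuous_on UNIV F"
  by (induction rule: polyfun.induct) (auto intro!: continuous_intros)

section \<open>Substitution of polynomial maps, rational maps and curves\<close>

lemma polyfun_compose: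
  assumes "polyfun F" "\<And>i. polyfun (\<lambda>v. \<Psi> v $ i)"
  shows "polyfun (\<lambda>v. F (\<Psi> v))"
  using assms by (induction rule: polyfun.induct) (auto intro: polyfun_intros)

text \<open>Clearing denominators: a power of the common denominator \<open>D\<close> makes the
  pullback polynomial.\<close>

lemma polyfun_subst_fractions:
  fixes \<Psi> :: "complex ^ 'm::finite \<Rightarrow> complex ^ 'n::finite"
  assumes "polyfun F" "polyfun D" "\<And>i. polyfun (\<lambda>v. E v $ i)"
    and \<Psi>: "\<And>v i. D v \<noteq> 0 \<Longrightarrow> \<Psi> v $ i = E v $ i / D v"
  shows "\<exists>N G. polyfun G \<and> (\<forall>v. D v \<noteq> 0 \<longrightarrow> G v = D v ^ N * F (\<Psi> v))"
  using assms(1)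
proof induction
  case (const c)
  show ?case by (rule exI[of _ 0], rule exI[of _ "\<lambda>v. c"]) (auto intro: polyfun_intros)
next
  case (coord i)
  show ?case by (rule exI[of _ 1], rule exI[of _ "\<lambda>v. E v $ i"]) (auto simp: \<Psi> assms)
next
  case (add F F')
  then obtain N G N' G' where G: "polyfun G" "\<forall>v. D v \<noteq> 0 \<longrightarrow> G v = D v ^ N * F (\<Psi> v)"
     "polyfun G'" "\<forall>v. D v \<noteq> 0 \<longrightarrow> G' v = D v ^ N' * F' (\<Psi> v)" by blast
  show ?case
    by (rule exI[of _ "N + N'"], rule exI[of _ "\<lambda>v. D v ^ N' * G v + D v ^ N * G' v"])
       (use G assms(2) in \<open>auto intro!: polyfun_intros simp: algebra_simps power_add\<close>)
next
  case (mult F F')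
  then obtain N G N' G' where G: "polyfun G" "\<forall>v. D v \<noteq> 0 \<longrightarrow> G v = D v ^ N * F (\<Psi> v)"
     "polyfun G'" "\<forall>v. D v \<noteq> 0 \<longrightarrow> G' v = D v ^ N' * F' (\<Psi> v)" by blast
  show ?case
    by (rule exI[of _ "N + N'"], rule exI[of _ "\<lambda>v. G v * G' v"])
       (use G in \<open>auto intro!: polyfun_intros simp: algebra_simps power_add\<close>)
qed

text \<open>One-variable version with values in \<open>complex poly\<close>, where roots, degrees
  and divisibility are available.\<close>

lemma polyfun_curve:
  fixes \<gamma> :: "complex \<Rightarrow> complex ^ 'n::finite"
  assumes "polyfun F" and \<gamma>: "\<And>t i. poly D t \<noteq> 0 \<Longrightarrow> \<gamma> t $ i = poly (E i) t / poly D t"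
  shows "\<exists>N G. \<forall>t. poly D t \<noteq> 0 \<longrightarrow> poly G t = poly D t ^ N * F (\<gamma> t)"
  using assms(1)
proof induction
  case (const c)
  show ?case by (rule exI[of _ 0], rule exI[of _ "[:c:]"]) auto
next
  case (coord i)
  show ?case by (rule exI[of _ 1], rule exI[of _ "E i"]) (auto simp: \<gamma>)
next
  case (add F F')
  then obtain N G N' G' where G: "\<forall>v. poly D v \<noteq> 0 \<longrightarrow> poly G v = poly D v ^ N * F (\<gamma> v)"
     "\<forall>v. poly D v \<noteq> 0 \<longrightarrow> poly G' v = poly D v ^ N' * F' (\<gamma> v)" by blast
  show ?case
    by (rule exI[of _ "N + N'"], rule exI[of _ "D ^ N' * G + D ^ N * G'"])
       (use G in \<open>auto simp: algebra_simps power_add\<close>)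
next
  case (mult F F')
  then obtain N G N' G' where G: "\<forall>v. poly D v \<noteq> 0 \<longrightarrow> poly G v = poly D v ^ N * F (\<gamma> v)"
     "\<forall>v. poly D v \<noteq> 0 \<longrightarrow> poly G' v = poly D v ^ N' * F' (\<gamma> v)" by blast
  show ?case
    by (rule exI[of _ "N + N'"], rule exI[of _ "G * G'"])
       (use G in \<open>auto simp: algebra_simps power_add\<close>)
qed

section \<open>Restriction to lines: absence of zero divisors, constancy of units\<close>

lemma polyfun_line:
  fixes a b :: "complex ^ 'n::finite"
  assumes "polyfun F"
  shows "\<exists>p. \<forall>t. poly p t = F (\<chi> i. a $ i + t * b $ i)"
proof -
  have "\<exists>N G. \<forall>t. poly 1 t \<noteq> (0::complex) \<longrightarrow> poly G t = poly 1 t ^ N * F (\<chi> i. a $ i + t * b $ i)"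
    by (rule polyfun_curve[OF assms, where E = "\<lambda>i. [:a $ i, b $ i:]"]) auto
  then show ?thesis by auto
qed

text \<open>On the line joining a nonzero of \<open>F\<close> to a nonzero of \<open>G\<close> both
  restrict to nonzero one-variable polynomials, whose product is nonzero.\<close>

lemma polyfun_mult_eq_0:
  assumes "polyfun F" "polyfun G" "\<And>v. F v * G v = 0"
  shows "(\<forall>v. F v = 0) \<or> (\<forall>v. G v = 0)"
proof (rule ccontr)
  assume "\<not> ?thesis"
  then obtain a b where ab: "F a \<noteq> 0" "G b \<noteq> 0" by auto
  let ?l = "\<lambda>t. \<chi> i. a $ i + t * (b - a) $ i"
  obtain p where p: "\<And>t. poly p t = F (?l t)" using polyfun_line[OF assms(1)] by blast
  obtain q where q: "\<And>t. poly q t = G (?l t)" using polyfun_line[OF assms(2)] by blast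
  have "?l 0 = a" "?l 1 = b" by (auto simp: vec_eq_iff)
  then have "poly p 0 \<noteq> 0" "poly q 1 \<noteq> 0" using p[of 0] q[of 1] ab by simp_all
  then have "p \<noteq> 0" "q \<noteq> 0" by auto
  moreover have "p * q = 0"
    using p q assms(3) poly_all_0_iff_0[of "p * q"] by simp
  ultimately show False by simp
qed

text \<open>By the fundamental theorem of algebra, the restriction to the line through
  \<open>v\<close> and \<open>w\<close> has no root and is therefore constant.\<close>

lemma polyfun_nowhere_zero_const:
  assumes "polyfun F" "\<And>v. F v \<noteq> 0"
  shows "F v = F w"
proof -
  let ?l = "\<lambda>t. \<chi> i. v $ i + t * (w - v) $ i"
  obtain p where p: "\<And>t. poly p t = F (?l t)" using polyfun_line[OF assms(1)] by blast
  have l: "?l 0 = v" "?l 1 = w" by (auto simp: vec_eq_iff)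
  have "\<And>t. poly p t \<noteq> 0" using p assms(2) by auto
  then have "constant (poly p)" using fundamental_theorem_of_algebra by blast
  then have "poly p 0 = poly p 1" by (auto simp: constant_def)
  then show ?thesis using p[of 0] p[of 1] l by simp
qed

lemma nonconstantI:
  assumes "poly_eval p a \<noteq> poly_eval p b"
  shows "nonconstant p"
proof (rule ccontr)
  assume "\<not> nonconstant p"
  then have "Poly_Mapping.keys p \<subseteq> {0}" by (auto simp: nonconstant_def)
  then have "poly_eval p x = Poly_Mapping.lookup p 0" for x
    using poly_eval_superset[of "{0}" p x] by simp
  then show False using assms by simp
qed

lemma hypersurface_polyfun:
  assumes "polyfun F" "F a \<noteq> F b"
  shows "hypersurface {v. F v = 0}"
proof -
  obtain p where p: "\<And>x. F x = poly_eval p x" using polyfun_imp_poly_eval[OF assms(1)] by blast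
  then have "nonconstant p" using nonconstantI[of p a b] assms(2) by simp
  then show ?thesis unfolding hypersurface_def using p by auto
qed

section \<open>Derivatives\<close>

lemma poly_eval_partial_deriv:
  "poly_eval (partial_deriv i p) a =
     (\<Sum>m\<in>Poly_Mapping.keys p. of_nat (Poly_Mapping.lookup m i) * Poly_Mapping.lookup p m *
        ((a $ i) ^ (Poly_Mapping.lookup m i - 1) * (\<Prod>j\<in>UNIV - {i}. (a $ j) ^ Poly_Mapping.lookup m j)))"
proof -
  have "(\<Prod>j\<in>UNIV. (a $ j) ^ Poly_Mapping.lookup (m - Poly_Mapping.single i 1) j) =
        (a $ i) ^ (Poly_Mapping.lookup m i - 1) * (\<Prod>j\<in>UNIV - {i}. (a $ j) ^ Poly_Mapping.lookup m j)" for m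
    by (subst prod.remove[of _ i]) (auto simp: lookup_minus lookup_single when_def intro!: prod.cong)
  then show ?thesis
    by (simp add: partial_deriv_def poly_eval_sum poly_eval_single)
qed

text \<open>The chain rule links formal partial derivatives to analytic ones, so that gradients and
  tangent vectors can be computed along curves.\<close>

lemma poly_eval_curve_derivative:
  fixes \<gamma> :: "complex \<Rightarrow> complex ^ 'n::finite"
  assumes \<gamma>: "\<And>i. ((\<lambda>t. \<gamma> t $ i) has_field_derivative d $ i) (at t)"
  shows "((\<lambda>t. poly_eval p (\<gamma> t)) has_field_derivative
           (\<Sum>i\<in>UNIV. poly_eval (partial_deriv i p) (\<gamma> t) * d $ i)) (at t)"
proof -
  let ?l = Poly_Mapping.lookup
  have mon: "((\<lambda>t. \<Prod>i\<in>UNIV. (\<gamma> t $ i) ^ ?l m i) has_field_derivative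
      (\<Sum>i\<in>UNIV. of_nat (?l m i) * (\<gamma> t $ i) ^ (?l m i - 1) * d $ i *
         (\<Prod>j\<in>UNIV - {i}. (\<gamma> t $ j) ^ ?l m j))) (at t)" for m
    by (rule has_field_derivative_prod) (auto intro!: derivative_eq_intros \<gamma>)
  have "((\<lambda>t. \<Sum>m\<in>Poly_Mapping.keys p. ?l p m * (\<Prod>i\<in>UNIV. (\<gamma> t $ i) ^ ?l m i)) has_field_derivative
      (\<Sum>m\<in>Poly_Mapping.keys p. ?l p m * (\<Sum>i\<in>UNIV. of_nat (?l m i) * (\<gamma> t $ i) ^ (?l m i - 1) * d $ i *
         (\<Prod>j\<in>UNIV - {i}. (\<gamma> t $ j) ^ ?l m j)))) (at t)"
    by (rule DERIV_sum, rule DERIV_cmult, rule mon)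
  also have "(\<Sum>m\<in>Poly_Mapping.keys p. ?l p m * (\<Sum>i\<in>UNIV. of_nat (?l m i) * (\<gamma> t $ i) ^ (?l m i - 1) * d $ i *
         (\<Prod>j\<in>UNIV - {i}. (\<gamma> t $ j) ^ ?l m j))) =
     (\<Sum>i\<in>UNIV. poly_eval (partial_deriv i p) (\<gamma> t) * d $ i)"
    unfolding poly_eval_partial_deriv sum_distrib_left sum_distrib_right
    by (subst (2) sum.swap) (intro sum.cong refl, simp only: mult.assoc mult.commute mult.left_commute)
  finally show ?thesis by (simp add: poly_eval_def)
qed

section \<open>Regular functions\<close>

lemma zariski_openE:
  assumes "zariski_open U" "a \<in> U"
  obtains p where "poly_eval p a \<noteq> 0" "\<And>x. poly_eval p x \<noteq> 0 \<Longrightarrow> x \<in> U"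
proof -
  obtain P where "- U = {x. \<forall>p\<in>P. poly_eval p x = 0}"
    using assms(1) by (auto simp: zariski_open_def zariski_closed_def)
  then have U: "x \<in> U \<longleftrightarrow> (\<exists>p\<in>P. poly_eval p x \<noteq> 0)" for x by blast
  then show ?thesis using that assms(2) by blast
qed

lemma zariski_open_UNIV: "zariski_open UNIV"
  unfolding zariski_open_def zariski_closed_def
  by (intro exI[of _ "{Poly_Mapping.single 0 1}"]) (simp add: poly_eval_single del: single_one)

lemma regular_on_quotient:
  assumes "polyfun E" "polyfun D" "\<And>x. x \<in> X \<Longrightarrow> D x \<noteq> 0 \<and> f x = E x / D x"
  shows "regular_on X f"
proof -
  obtain g h where "\<And>x. E x = poly_eval g x" "\<And>x. D x = poly_eval h x"
    using polyfun_imp_poly_eval assms(1,2) by meson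
  then have "\<forall>x\<in>X \<inter> UNIV. poly_eval h x \<noteq> 0 \<and> f x = poly_eval g x / poly_eval h x"
    using assms(3) by simp
  then show ?thesis
    unfolding regular_on_def using zariski_open_UNIV by blast
qed

lemma regular_on_polyfun: "polyfun f \<Longrightarrow> regular_on X f"
  by (rule regular_on_quotient[of f "\<lambda>_. 1"]) (auto intro: polyfun.const)

text \<open>In the Euclidean topology Zariski neighbourhoods are open and polynomials continuous.
  This extends formulas from a dense part of a variety by limits.\<close>

lemma regular_on_continuous:
  assumes "regular_on X f"
  shows "continuous_on X f"
proof (subst continuous_on_eq_continuous_within, rule ballI)
  fix a assume a: "a \<in> X"
  then obtain U g h where U: "zariski_open U" "a \<in> U"
    and gh: "\<And>x. x \<in> X \<inter> U \<Longrightarrow> poly_eval h x \<noteq> 0 \<and> f x = poly_eval g x / poly_eval h x"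
    using assms unfolding regular_on_def by blast
  obtain p where p: "poly_eval p a \<noteq> 0" "\<And>x. poly_eval p x \<noteq> 0 \<Longrightarrow> x \<in> U"
    using zariski_openE[OF U] by blast
  have cont: "continuous (at a within X) (poly_eval r)" for r :: "'a cpoly"
    using continuous_polyfun[OF polyfun_poly_eval, of r]
    by (meson continuous_on_eq_continuous_within continuous_within_subset subset_UNIV UNIV_I)
  have "eventually (\<lambda>x. poly_eval p x \<noteq> 0) (at a within X)"
    using cont[of p] p(1) unfolding continuous_within by (rule tendsto_imp_eventually_ne)
  moreover have "eventually (\<lambda>x. x \<in> X) (at a within X)"
    by (simp add: eventually_at_filter)
  ultimately have ev: "eventually (\<lambda>x. poly_eval g x / poly_eval h x = f x) (at a within X)"
    by eventually_elim (use gh p in auto)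
  have "((\<lambda>x. poly_eval g x / poly_eval h x) \<longlongrightarrow> poly_eval g a / poly_eval h a) (at a within X)"
    using cont[of g] cont[of h] gh[of a] a U by (intro tendsto_divide) (auto simp: continuous_within)
  then show "continuous (at a within X) f"
    unfolding continuous_within using Lim_transform_eventually[OF _ ev] gh[of a] a U by simp
qed

text \<open>Local quotients along a rational curve glue to one quotient: among all denominators
  valid on \<open>D \<noteq> 0\<close>, one of least degree cannot vanish there, since at a zero
  \<open>b\<close> the factor t - b would cancel.\<close>

lemma regular_on_rational_curve:
  fixes \<gamma> :: "complex \<Rightarrow> complex ^ 'n::finite"
  assumes f: "regular_on X f" and D: "D \<noteq> 0"
    and \<gamma>: "\<And>t i. poly D t \<noteq> 0 \<Longrightarrow> \<gamma> t $ i = poly (E i) t / poly D t"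
    and X: "\<And>t. poly D t \<noteq> 0 \<Longrightarrow> \<gamma> t \<in> X"
  shows "\<exists>g h. \<forall>t. poly D t \<noteq> 0 \<longrightarrow> poly h t \<noteq> 0 \<and> f (\<gamma> t) = poly g t / poly h t"
proof -
  have pull: "\<exists>N G. \<forall>t. poly D t \<noteq> 0 \<longrightarrow> poly G t = poly D t ^ N * poly_eval p (\<gamma> t)" for p
    by (rule polyfun_curve[OF polyfun_poly_eval]) (rule \<gamma>)
  have loc: "\<exists>g h r. poly r a \<noteq> 0 \<and>
      (\<forall>t. poly D t \<noteq> 0 \<and> poly r t \<noteq> 0 \<longrightarrow> poly h t \<noteq> 0 \<and> f (\<gamma> t) * poly h t = poly g t)"
    if a: "poly D a \<noteq> 0" for a
  proof -
    obtain U g h where U: "zariski_open U" "\<gamma> a \<in> U"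
      and gh: "\<And>x. x \<in> X \<inter> U \<Longrightarrow> poly_eval h x \<noteq> 0 \<and> f x = poly_eval g x / poly_eval h x"
      using f X[OF a] unfolding regular_on_def by blast
    obtain p where p: "poly_eval p (\<gamma> a) \<noteq> 0" "\<And>x. poly_eval p x \<noteq> 0 \<Longrightarrow> x \<in> U"
      using zariski_openE[OF U] by blast
    obtain N1 G1 where G1: "\<And>t. poly D t \<noteq> 0 \<Longrightarrow> poly G1 t = poly D t ^ N1 * poly_eval g (\<gamma> t)"
      using pull[of g] by blast
    obtain N2 G2 where G2: "\<And>t. poly D t \<noteq> 0 \<Longrightarrow> poly G2 t = poly D t ^ N2 * poly_eval h (\<gamma> t)"
      using pull[of h] by blast
    obtain N3 r where r: "\<And>t. poly D t \<noteq> 0 \<Longrightarrow> poly r t = poly D t ^ N3 * poly_eval p (\<gamma> t)"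
      using pull[of p] by blast
    have "poly (D ^ N1 * G2) t \<noteq> 0 \<and> f (\<gamma> t) * poly (D ^ N1 * G2) t = poly (D ^ N2 * G1) t"
      if t: "poly D t \<noteq> 0" "poly r t \<noteq> 0" for t
    proof -
      have "\<gamma> t \<in> X \<inter> U" using t r[of t] p(2) X by auto
      from gh[OF this] show ?thesis using t(1) by (simp add: G1 G2 field_simps)
    qed
    moreover have "poly r a \<noteq> 0" using r[OF a] a p(1) by simp
    ultimately show ?thesis by blast
  qed
  \<comment> \<open>The cross-multiplied form is meaningful also at zeros of \<open>h\<close>; a
    local equation becomes valid on all of \<open>D \<noteq> 0\<close> after multiplication by
    \<open>r\<close>.\<close>
  define Q where "Q h g \<longleftrightarrow> h \<noteq> 0 \<and> (\<forall>t. poly D t \<noteq> 0 \<longrightarrow> f (\<gamma> t) * poly h t = poly g t)" for h g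
  have "\<exists>h. \<exists>g. Q h g"
  proof -
    obtain a where a: "poly D a \<noteq> 0" using D poly_all_0_iff_0 by blast
    then obtain g h r where ghr: "poly r a \<noteq> 0" "\<And>t. poly D t \<noteq> 0 \<Longrightarrow> poly r t \<noteq> 0 \<Longrightarrow>
       poly h t \<noteq> 0 \<and> f (\<gamma> t) * poly h t = poly g t" using loc by blast
    have "f (\<gamma> t) * poly (h * r) t = poly (g * r) t" if "poly D t \<noteq> 0" for t
      using ghr(2)[OF that] by (cases "poly r t = 0") (auto simp: mult.assoc[symmetric])
    moreover have "h \<noteq> 0" "r \<noteq> 0" using ghr a by auto
    ultimately have "Q (h * r) (g * r)" unfolding Q_def by simp
    then show ?thesis by blast
  qed
  then obtain h where h: "\<exists>g. Q h g" and min: "\<And>h'. \<exists>g. Q h' g \<Longrightarrow> degree h \<le> degree h'"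
    using ex_has_least_nat[of "\<lambda>h. \<exists>g. Q h g" _ degree] by blast
  from h obtain g where g: "Q h g" by blast
  have "poly h b \<noteq> 0" if b: "poly D b \<noteq> 0" for b
  proof
    assume hb: "poly h b = 0"
    then have "poly g b = 0" using g b unfolding Q_def by (metis mult_zero_right)
    then obtain h' g' where h': "h = [:- b, 1:] * h'" and g': "g = [:- b, 1:] * g'"
      using hb by (meson dvdE poly_eq_0_iff_dvd)
    have eq: "f (\<gamma> t) * poly h' t = poly g' t" if "poly D t \<noteq> 0" "t \<noteq> b" for t
    proof -
      have "f (\<gamma> t) * ((t - b) * poly h' t) = (t - b) * poly g' t"
        using g that(1) unfolding Q_def h' g' by (auto simp: algebra_simps)
      then show ?thesis using that(2) by auto
    qed
    \<comment> \<open>So far the cancelled equation is known only for t \<noteq> b. At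
      \<open>b\<close> it follows by comparison with a local quotient \<open>g1 / h1\<close>: the
      cross products agree at all but finitely many points, hence as polynomials.\<close>
    obtain g1 h1 r1 where 1: "poly r1 b \<noteq> 0" "\<And>t. poly D t \<noteq> 0 \<Longrightarrow> poly r1 t \<noteq> 0 \<Longrightarrow>
       poly h1 t \<noteq> 0 \<and> f (\<gamma> t) * poly h1 t = poly g1 t" using loc[OF b] by blast
    have "poly (D * r1 * [:- b, 1:] * (g1 * h' - g' * h1)) t = 0" for t
    proof (cases "poly D t = 0 \<or> poly r1 t = 0 \<or> t = b")
      case False
      then have "poly g1 t * poly h' t = poly g' t * poly h1 t"
        using 1(2)[of t] eq[of t] by (metis mult.assoc mult.commute)
      then show ?thesis by simp
    qed auto
    then have "D * r1 * [:- b, 1:] * (g1 * h' - g' * h1) = 0" using poly_all_0_iff_0 by blast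
    moreover have "r1 \<noteq> 0" using 1(1) by auto
    ultimately have "g1 * h' = g' * h1"
      using D by (metis eq_iff_diff_eq_0 mult_eq_0_iff one_neq_zero pCons_eq_0_iff)
    then have "poly g1 b * poly h' b = poly g' b * poly h1 b" by (metis poly_mult)
    moreover have "poly h1 b \<noteq> 0" "f (\<gamma> b) * poly h1 b = poly g1 b" using 1(2)[OF b 1(1)] by auto
    ultimately have "poly h1 b * (f (\<gamma> b) * poly h' b) = poly h1 b * poly g' b"
      by (simp add: algebra_simps)
    then have "f (\<gamma> b) * poly h' b = poly g' b" using \<open>poly h1 b \<noteq> 0\<close> by simp
    then have "Q h' g'" using eq g unfolding Q_def h' by auto
    then have "degree h \<le> degree h'" using min by blast
    moreover    have "h' \<noteq> 0" using g h' unfolding Q_def by auto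
    then have "degree h = Suc (degree h')"
      unfolding h' using degree_mult_eq[of "[:- b, 1:]" h'] by simp
    ultimately show False by simp
  qed
  moreover have "f (\<gamma> t) = poly g t / poly h t" if "poly D t \<noteq> 0" "poly h t \<noteq> 0" for t
    using g that unfolding Q_def by (simp add: field_simps)
  ultimately show ?thesis by blast
qed

section \<open>Units on the punctured and on the full affine line\<close>

lemma poly_root_free_punctured:
  fixes p :: "complex poly"
  assumes "\<And>t. t \<noteq> 0 \<Longrightarrow> poly p t \<noteq> 0"
  shows "\<exists>c n. c \<noteq> 0 \<and> (\<forall>t. poly p t = c * t ^ n)"
proof -
  have "p \<noteq> 0" using assms[of 1] by auto
  then obtain q where q: "p = [:- 0, 1:] ^ order 0 p * q" "\<not> [:- 0, 1:] dvd q"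
    using order_decomp by blast
  have "poly q t \<noteq> 0" for t
  proof (cases "t = 0")
    case True
    then show ?thesis using q(2) by (simp add: poly_eq_0_iff_dvd)
  next
    case False
    then show ?thesis using assms[of t] arg_cong[OF q(1), of "\<lambda>p. poly p t"] by auto
  qed
  then have "constant (poly q)" using fundamental_theorem_of_algebra by blast
  then have "poly q t = poly q 0" for t by (auto simp: constant_def)
  moreover have "poly p t = t ^ order 0 p * poly q t" for t
    using arg_cong[OF q(1), of "\<lambda>p. poly p t"] by simp
  ultimately have "poly p t = poly q 0 * t ^ order 0 p" for t by (simp add: mult.commute)
  then show ?thesis using \<open>\<And>t. poly q t \<noteq> 0\<close> by blast
qed

text \<open>Numerator and denominator of the pulled-back unit have no roots besides 0, so both are
  monomials.\<close>

lemma regular_unit_on_punctured_line: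
  fixes \<gamma> :: "complex \<Rightarrow> complex ^ 'n::finite"
  assumes "regular_on X f" "\<And>x. x \<in> X \<Longrightarrow> f x \<noteq> 0"
    and "\<And>t i. t \<noteq> 0 \<Longrightarrow> \<gamma> t $ i = poly (E i) t / t ^ N"
    and "\<And>t. t \<noteq> 0 \<Longrightarrow> \<gamma> t \<in> X"
  shows "\<exists>c n. c \<noteq> 0 \<and> (\<forall>t. t \<noteq> 0 \<longrightarrow> f (\<gamma> t) = c * t powi n)"
proof -
  \<comment> \<open>The exponent is \<open>Suc N\<close> so that \<open>D\<close> vanishes at 0 even
    for \<open>N = 0\<close>; the curve is only known to lie in \<open>X\<close> for t \<noteq>
    0.\<close>
  define D where "D = monom (1::complex) (Suc N)"
  have D: "poly D t = t ^ Suc N" for t by (simp add: D_def poly_monom)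
  have "\<exists>g h. \<forall>t. poly D t \<noteq> 0 \<longrightarrow> poly h t \<noteq> 0 \<and> f (\<gamma> t) = poly g t / poly h t"
    by (rule regular_on_rational_curve[OF assms(1), where E = "\<lambda>i. [:0,1:] * E i"])
       (use assms D in \<open>auto simp: D_def\<close>)
  then obtain g h where gh: "\<And>t. t \<noteq> 0 \<Longrightarrow> poly h t \<noteq> 0 \<and> f (\<gamma> t) = poly g t / poly h t"
    using D by auto
  then have "\<And>t. t \<noteq> 0 \<Longrightarrow> poly h t \<noteq> 0" "\<And>t. t \<noteq> 0 \<Longrightarrow> poly g t \<noteq> 0"
    using assms by fastforce+
  then obtain c n d m where "c \<noteq> 0" "d \<noteq> 0" "\<And>t. poly h t = c * t ^ n" "\<And>t. poly g t = d * t ^ m"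
    using poly_root_free_punctured by metis
  then have "f (\<gamma> t) = d / c * t powi (int m - int n)" if "t \<noteq> 0" for t
    using gh[OF that] that by (simp add: power_int_diff)
  then show ?thesis using \<open>c \<noteq> 0\<close> \<open>d \<noteq> 0\<close> by (intro exI[of _ "d / c"] exI[of _ "int m - int n"]) auto
qed

text \<open>On the full line numerator and denominator have no roots at all, hence are
  constant.\<close>

lemma regular_unit_on_line:
  fixes \<gamma> :: "complex \<Rightarrow> complex ^ 'n::finite"
  assumes "regular_on X f" "\<And>x. x \<in> X \<Longrightarrow> f x \<noteq> 0"
    and "\<And>t i. \<gamma> t $ i = poly (E i) t" and "\<And>t. \<gamma> t \<in> X"
  shows "f (\<gamma> s) = f (\<gamma> t)"
proof -
  have "\<exists>g h. \<forall>t. poly 1 t \<noteq> (0::complex) \<longrightarrow> poly h t \<noteq> 0 \<and> f (\<gamma> t) = poly g t / poly h t"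
    by (rule regular_on_rational_curve[OF assms(1), where E = E]) (use assms in auto)
  then obtain g h where gh: "\<And>t. poly h t \<noteq> 0" "\<And>t. f (\<gamma> t) = poly g t / poly h t" by auto
  then have "\<And>t. poly g t \<noteq> 0" using assms by fastforce
  then have "constant (poly g)" "constant (poly h)"
    using gh(1) fundamental_theorem_of_algebra by blast+
  then have "poly g s = poly g t" "poly h s = poly h t" by (auto simp: constant_def)
  then show ?thesis using gh by simp
qed

section \<open>Irreducibility and smoothness from a dense subset\<close>

text \<open>\<open>H\<close> has a dense subset that is the image of a nonempty principal open set
  of affine space under a rational map. Euclidean density suffices, since zero sets of polynomials
  are closed in that topology.\<close>

lemma zariski_irreducibleI:
  fixes \<Psi> :: "complex ^ 'm::finite \<Rightarrow> complex ^ 'n::finite"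
  assumes D: "polyfun D" "D a \<noteq> 0" and E: "\<And>i. polyfun (\<lambda>v. E v $ i)"
    and \<Psi>: "\<And>v i. D v \<noteq> 0 \<Longrightarrow> \<Psi> v $ i = E v $ i / D v"
    and H: "\<And>v. D v \<noteq> 0 \<Longrightarrow> \<Psi> v \<in> H" "H \<subseteq> closure (\<Psi> ` {v. D v \<noteq> 0})"
  shows "zariski_irreducible H"
  unfolding zariski_irreducible_def
proof (intro conjI allI impI)
  show "H \<noteq> {}" using H(1) D(2) by blast
  fix A B assume "zariski_closed A" "zariski_closed B" and HAB: "H \<subseteq> A \<union> B"
  then obtain P Q where A: "A = {x. \<forall>p\<in>P. poly_eval p x = 0}" and B: "B = {x. \<forall>p\<in>Q. poly_eval p x = 0}"
    unfolding zariski_closed_def by auto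
  have wit: "\<exists>v. D v \<noteq> 0 \<and> poly_eval p (\<Psi> v) \<noteq> 0" if "x \<in> H" "poly_eval p x \<noteq> 0" for p x
  proof (rule ccontr)
    assume "\<not> ?thesis"
    then have "\<Psi> ` {v. D v \<noteq> 0} \<subseteq> {x. poly_eval p x = 0}" by auto
    moreover have "closed {x. poly_eval p x = 0}"
      using continuous_polyfun[OF polyfun_poly_eval, of p]
      by (intro closed_Collect_eq) auto
    ultimately have "closure (\<Psi> ` {v. D v \<noteq> 0}) \<subseteq> {x. poly_eval p x = 0}"
      by (rule closure_minimal)
    then show False using that H(2) by auto
  qed
  show "H \<subseteq> A \<or> H \<subseteq> B"
  proof (rule ccontr)
    assume "\<not> (H \<subseteq> A \<or> H \<subseteq> B)"
    then obtain p q x y where pq: "p \<in> P" "q \<in> Q" "x \<in> H" "poly_eval p x \<noteq> 0" "y \<in> H" "poly_eval q y \<noteq> 0"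
      unfolding A B by blast
    obtain N1 G1 where G1: "polyfun G1" "\<And>v. D v \<noteq> 0 \<Longrightarrow> G1 v = D v ^ N1 * poly_eval p (\<Psi> v)"
      using polyfun_subst_fractions[OF polyfun_poly_eval D(1) E \<Psi>] by blast
    obtain N2 G2 where G2: "polyfun G2" "\<And>v. D v \<noteq> 0 \<Longrightarrow> G2 v = D v ^ N2 * poly_eval q (\<Psi> v)"
      using polyfun_subst_fractions[OF polyfun_poly_eval D(1) E \<Psi>] by blast
    \<comment> \<open>The factors \<open>D\<close> extend the vanishing of the product to the zeros
      of \<open>D\<close>, so that the absence of zero divisors applies.\<close>
    have "(D v * G1 v) * (D v * G2 v) = 0" for v
    proof (cases "D v = 0")
      case False
      then have "\<Psi> v \<in> A \<union> B" using H(1) HAB by blast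
      then show ?thesis using pq G1(2)[OF False] G2(2)[OF False] unfolding A B by auto
    qed simp
    then have "(\<forall>v. D v * G1 v = 0) \<or> (\<forall>v. D v * G2 v = 0)"
      by (intro polyfun_mult_eq_0 polyfun.mult D(1) G1(1) G2(1))
    moreover obtain v where "D v \<noteq> 0" "poly_eval p (\<Psi> v) \<noteq> 0" using wit pq by blast
    moreover obtain w where "D w \<noteq> 0" "poly_eval q (\<Psi> w) \<noteq> 0" using wit pq by blast
    ultimately show False using G1(2) G2(2) by (metis mult_eq_0_iff power_not_zero)
  qed
qed

section \<open>Tangent spaces and a smoothness criterion\<close>

lemma vec_dim_hyperplane:
  fixes c :: "complex ^ 'n::finite"
  assumes "c $ l \<noteq> 0"
  shows "vec.dim {v. (\<Sum>i\<in>UNIV. c $ i * v $ i) = 0} = CARD('n) - 1"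
proof -
  let ?K = "{v. (\<Sum>i\<in>UNIV. c $ i * v $ i) = 0}"
  let ?e = "axis l (1::complex)"
  have sub: "vec.subspace ?K"
  proof (rule vec.subspaceI)
    fix k x assume "x \<in> ?K"
    moreover have "(\<Sum>i\<in>UNIV. c $ i * (k *s x) $ i) = k * (\<Sum>i\<in>UNIV. c $ i * x $ i)"
      by (simp add: sum_distrib_left mult.left_commute)
    ultimately show "k *s x \<in> ?K" by simp
  qed (auto simp: distrib_left sum.distrib)
  have e: "(\<Sum>i\<in>UNIV. c $ i * ?e $ i) = c $ l"
    by (simp add: axis_def if_distrib cong: if_cong)
  then have "?e \<notin> vec.span ?K" using assms sub by (simp add: vec.span_eq_iff[THEN iffD2])
  then have "vec.dim (insert ?e ?K) = vec.dim ?K + 1" by (simp add: vec.dim_insert)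
  moreover have "vec.span (insert ?e ?K) = UNIV"
  proof -
    have "v \<in> vec.span (insert ?e ?K)" for v
    proof -
      define k where "k = (\<Sum>i\<in>UNIV. c $ i * v $ i) / c $ l"
      have "(\<Sum>i\<in>UNIV. c $ i * (v - k *s ?e) $ i) = (\<Sum>i\<in>UNIV. c $ i * v $ i) - k * (\<Sum>i\<in>UNIV. c $ i * ?e $ i)"
        by (simp add: right_diff_distrib sum_subtractf sum_distrib_left mult.left_commute)
      also have "\<dots> = 0" unfolding e using assms by (simp add: k_def)
      finally have "v - k *s ?e \<in> ?K" by simp
      then show ?thesis unfolding vec.span_insert using sub by (auto simp: vec.span_eq_iff[THEN iffD2])
    qed
    then show ?thesis by auto
  qed
  then have "vec.dim (insert ?e ?K) = CARD('n)"
    by (metis vec.dim_span vec_dim_card)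
  ultimately show ?thesis by simp
qed

text \<open>A polynomial of the vanishing ideal is locally zero along the curve, and so is its
  derivative. This bounds tangent spaces from below without generators of the ideal.\<close>

lemma tangent_space_velocity:
  fixes \<gamma> :: "complex \<Rightarrow> complex ^ 'n::finite"
  assumes "\<And>i. ((\<lambda>t. \<gamma> t $ i) has_field_derivative d $ i) (at 0)"
    and "\<forall>\<^sub>F t in nhds 0. \<gamma> t \<in> X"
  shows "d \<in> tangent_space X (\<gamma> 0)"
  unfolding tangent_space_def
proof safe
  fix p assume "p \<in> vanishing_ideal X"
  then have "\<forall>\<^sub>F t in nhds 0. poly_eval p (\<gamma> t) = 0"
    using assms(2) by (auto simp: vanishing_ideal_def elim: eventually_mono)
  then have "((\<lambda>t. poly_eval p (\<gamma> t)) has_field_derivative 0) (at 0)"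
    by (subst DERIV_cong_ev[OF refl _ refl, where g = "\<lambda>_. 0"]) auto
  then show "(\<Sum>i\<in>UNIV. poly_eval (partial_deriv i p) (\<gamma> 0) * d $ i) = 0"
    using poly_eval_curve_derivative[of \<gamma> d 0 p] assms(1) DERIV_unique by blast
qed

text \<open>
  The \<open>2 \<times> 2\<close> minors of the gradients of \<open>P\<close> and of any \<open>p\<close> in the vanishing ideal vanish on the dense
  set \<open>G\<close>, hence everywhere.
\<close>

lemma smooth_hypersurfaceI:
  fixes P :: "'n::finite cpoly"
  defines "H \<equiv> {x. poly_eval P x = 0}"
  assumes "nonconstant P"
    and grad: "\<And>a. a \<in> H \<Longrightarrow> \<exists>i. poly_eval (partial_deriv i P) a \<noteq> 0"
    and dense: "G \<subseteq> H" "H \<subseteq> closure G"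
    and arcs: "\<And>a. a \<in> G \<Longrightarrow> poly_eval (partial_deriv l P) a \<noteq> 0 \<and>
      (\<forall>v. \<exists>\<gamma> d. \<gamma> 0 = a \<and> (\<forall>i. ((\<lambda>t. \<gamma> t $ i) has_field_derivative d $ i) (at 0)) \<and>
         (\<forall>i. i \<noteq> l \<longrightarrow> d $ i = v $ i) \<and> (\<forall>\<^sub>F t in nhds 0. \<gamma> t \<in> H))"
  shows "smooth_hypersurface H"
proof -
  let ?d = "\<lambda>p a i. poly_eval (partial_deriv i p) a"
  have PH: "P \<in> vanishing_ideal H" by (auto simp: vanishing_ideal_def H_def)
  have on_G: "(\<Sum>i\<in>UNIV. ?d p a i * v $ i) = 0"
    if a: "a \<in> G" and p: "p \<in> vanishing_ideal H" and v: "(\<Sum>i\<in>UNIV. ?d P a i * v $ i) = 0" for a p v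
  proof -
    obtain \<gamma> d where \<gamma>: "\<gamma> 0 = a" "\<And>i. ((\<lambda>t. \<gamma> t $ i) has_field_derivative d $ i) (at 0)"
      "\<And>i. i \<noteq> l \<Longrightarrow> d $ i = v $ i" "\<forall>\<^sub>F t in nhds 0. \<gamma> t \<in> H"
      using arcs[OF a] by meson
    have d: "d \<in> tangent_space H a" using tangent_space_velocity[OF \<gamma>(2,4)] \<gamma>(1) by simp
    then have "(\<Sum>i\<in>UNIV. ?d P a i * d $ i) = 0" using PH by (auto simp: tangent_space_def)
    \<comment> \<open>\<open>d\<close> and \<open>v\<close> agree outside \<open>l\<close>, and both
      are annihilated by the gradient of \<open>P\<close>, whose \<open>l\<close>-th entry is
      nonzero on \<open>G\<close>.\<close>
    then have "?d P a l * d $ l = ?d P a l * v $ l"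
      using v \<gamma>(3) by (simp add: sum.remove[of UNIV l] add_eq_0_iff2)
    then have "d $ l = v $ l" using arcs[OF a] by simp
    then have "d = v" using \<gamma>(3) by (metis vec_eq_iff)
    then show ?thesis using d p by (auto simp: tangent_space_def)
  qed
  have minors: "?d p a i * ?d P a j - ?d p a j * ?d P a i = 0"
    if a: "a \<in> H" and p: "p \<in> vanishing_ideal H" for a p i j
  proof -
    let ?M = "\<lambda>a. ?d p a i * ?d P a j - ?d p a j * ?d P a i"
    have "?M a = 0" if "a \<in> G" for a
    proof -
      \<comment> \<open>The gradient of \<open>P\<close> annihilates this vector; pairing it with
        the gradient of \<open>p\<close> gives the minor.\<close>
      let ?v = "?d P a j *s axis i 1 - ?d P a i *s axis j 1"
      have ax: "(\<Sum>k\<in>UNIV. f k * (axis m (1::complex)) $ k) = f m" for f :: "'n \<Rightarrow> complex" and m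
        by (simp add: axis_def if_distrib cong: if_cong)
      have "(\<Sum>k\<in>UNIV. f k * ?v $ k) = ?d P a j * (\<Sum>k\<in>UNIV. f k * axis i 1 $ k) -
          ?d P a i * (\<Sum>k\<in>UNIV. f k * axis j 1 $ k)" for f :: "'n \<Rightarrow> complex"
        by (simp add: right_diff_distrib sum_subtractf sum_distrib_left mult.left_commute)
      then have "(\<Sum>k\<in>UNIV. f k * ?v $ k) = f i * ?d P a j - f j * ?d P a i" for f :: "'n \<Rightarrow> complex"
        by (simp add: ax mult.commute)
      then show ?thesis using on_G[OF that p, of ?v] by simp
    qed
    then have "G \<subseteq> {a. ?M a = 0}" by auto
    moreover have "closed {a. ?M a = 0}"
      by (intro closed_Collect_eq continuous_polyfun continuous_on_const polyfun_intros polyfun_poly_eval)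
    ultimately have "closure G \<subseteq> {a. ?M a = 0}" by (rule closure_minimal)
    then show ?thesis using a dense by auto
  qed
  have "vec.dim (tangent_space H a) = CARD('n) - 1" if a: "a \<in> H" for a
  proof -
    obtain l where l: "?d P a l \<noteq> 0" using grad[OF a] by blast
    have "tangent_space H a = {v. (\<Sum>i\<in>UNIV. (\<chi> i. ?d P a i) $ i * v $ i) = 0}"
    proof (intro equalityI subsetI)
      fix v assume "v \<in> tangent_space H a"
      then show "v \<in> {v. (\<Sum>i\<in>UNIV. (\<chi> i. ?d P a i) $ i * v $ i) = 0}"
        using PH by (auto simp: tangent_space_def)
    next
      fix v assume v: "v \<in> {v. (\<Sum>i\<in>UNIV. (\<chi> i. ?d P a i) $ i * v $ i) = 0}"
      have "(\<Sum>i\<in>UNIV. ?d p a i * v $ i) = 0" if p: "p \<in> vanishing_ideal H" for p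
      proof -
        \<comment> \<open>With pivot \<open>l\<close> the vanishing minors say that the gradient of
          \<open>p\<close> is \<open>k\<close> times that of \<open>P\<close>.\<close>
        define k where "k = ?d p a l / ?d P a l"
        have k: "?d p a i = k * ?d P a i" for i
          using minors[OF a p, of i l] l by (simp add: k_def field_simps)
        have "(\<Sum>i\<in>UNIV. ?d p a i * v $ i) = (\<Sum>i\<in>UNIV. k * (?d P a i * v $ i))"
          by (simp only: k mult.assoc)
        also have "\<dots> = k * (\<Sum>i\<in>UNIV. ?d P a i * v $ i)" by (rule sum_distrib_left[symmetric])
        also have "\<dots> = 0" using v by simp
        finally show ?thesis .
      qed
      then show "v \<in> tangent_space H a" by (simp add: tangent_space_def)
    qed
    then show ?thesis using vec_dim_hyperplane[of "\<chi> i. ?d P a i" l] l by simp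
  qed
  then show ?thesis
    using assms(2) unfolding smooth_hypersurface_def hypersurface_def H_def by blast
qed

section \<open>A family of hypersurfaces with isomorphic complements\<close>

text \<open>The divided difference of the k-th power; written as a sum it makes sense for a = b
  too.\<close>

definition diff_quot :: "nat \<Rightarrow> complex \<Rightarrow> complex \<Rightarrow> complex" where
  "diff_quot k a b = (\<Sum>i<k. b ^ (k - Suc i) * a ^ i)"

lemma diff_quot: "a ^ k - b ^ k = (a - b) * diff_quot k a b"
  unfolding diff_quot_def by (rule power_diff_sumr2)

text \<open>
  For fixed \<open>c\<close>, the level set \<open>G x\<^sup>2 y + F + x G F ^ k = c\<close> is carried by a polynomial change of
  the coordinate \<open>y\<close> to \<open>G x\<^sup>2 y + F + x G c ^ k = c\<close>, since \<open>F - c\<close> is divisible by \<open>x G\<close>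
  on it.
\<close>

definition to_model :: "complex \<Rightarrow> complex \<Rightarrow> nat \<Rightarrow> complex \<Rightarrow> complex \<Rightarrow> complex \<Rightarrow> complex" where
  "to_model G F k c x y = y - G * (x * y + F ^ k) * diff_quot k F c"

definition of_model :: "complex \<Rightarrow> complex \<Rightarrow> nat \<Rightarrow> complex \<Rightarrow> complex \<Rightarrow> complex \<Rightarrow> complex" where
  "of_model G F k c x y = y + G * (x * y + c ^ k) * diff_quot k F c"

lemma to_model:
  assumes "G * x\<^sup>2 * y + F + x * G * F ^ k = c"
  shows "G * x\<^sup>2 * to_model G F k c x y + F + x * G * c ^ k = c"
    and "of_model G F k c x (to_model G F k c x y) = y"
proof -
  define D where "D = diff_quot k F c"
  have Fc: "F - c = - (x * G * (x * y + F ^ k))"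
    using assms by (simp add: algebra_simps power2_eq_square)
  have Fk: "F ^ k - c ^ k = (F - c) * D" unfolding D_def by (rule diff_quot)
  have T: "to_model G F k c x y = y - G * (x * y + F ^ k) * D" by (simp add: to_model_def D_def)
  have "x * to_model G F k c x y + c ^ k = x * y + (F - c) * D + c ^ k"
    unfolding T Fc by (simp add: algebra_simps)
  \<comment> \<open>\<open>x * y + F ^ k\<close> is the cofactor of \<open>- x * G\<close> in
    \<open>F - c\<close>, and the change of \<open>y\<close> keeps its value. Both claims follow
    from this invariance.\<close>
  then have *: "x * to_model G F k c x y + c ^ k = x * y + F ^ k" unfolding Fk[symmetric] by simp
  then show "of_model G F k c x (to_model G F k c x y) = y"
    unfolding of_model_def by (simp add: T D_def)
  have "G * x\<^sup>2 * to_model G F k c x y + F + x * G * c ^ k =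
        x * G * (x * to_model G F k c x y + c ^ k) + F"
    by (simp add: algebra_simps power2_eq_square)
  then show "G * x\<^sup>2 * to_model G F k c x y + F + x * G * c ^ k = c"
    unfolding * using Fc by (simp add: algebra_simps)
qed

lemma of_model:
  assumes "G * x\<^sup>2 * y + F + x * G * c ^ k = c"
  shows "G * x\<^sup>2 * of_model G F k c x y + F + x * G * F ^ k = c"
    and "to_model G F k c x (of_model G F k c x y) = y"
proof -
  define D where "D = diff_quot k F c"
  have Fc: "F - c = - (x * G * (x * y + c ^ k))"
    using assms by (simp add: algebra_simps power2_eq_square)
  have Fk: "F ^ k - c ^ k = (F - c) * D" unfolding D_def by (rule diff_quot)
  have T: "of_model G F k c x y = y + G * (x * y + c ^ k) * D" by (simp add: of_model_def D_def)
  have "x * of_model G F k c x y + F ^ k = x * y - (F - c) * D + F ^ k"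
    unfolding T Fc by (simp add: algebra_simps)
  then have *: "x * of_model G F k c x y + F ^ k = x * y + c ^ k" unfolding Fk[symmetric] by simp
  then show "to_model G F k c x (of_model G F k c x y) = y"
    unfolding to_model_def by (simp add: T D_def)
  have "G * x\<^sup>2 * of_model G F k c x y + F + x * G * F ^ k =
        x * G * (x * of_model G F k c x y + F ^ k) + F"
    by (simp add: algebra_simps power2_eq_square)
  then show "G * x\<^sup>2 * of_model G F k c x y + F + x * G * F ^ k = c"
    unfolding * using Fc by (simp add: algebra_simps)
qed

section \<open>Three active coordinates in n-space and the family \<open>H f g k\<close>\<close>

locale three_coordinates =
  fixes ix iy iz :: "'n::finite"
  assumes distinct: "ix \<noteq> iy" "ix \<noteq> iz" "iy \<noteq> iz"
begin

text \<open>Points are described by their three active coordinates over a base point that carries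
  the passive ones.\<close>

definition upd :: "complex ^ 'n \<Rightarrow> complex \<Rightarrow> complex \<Rightarrow> complex \<Rightarrow> complex ^ 'n" where
  "upd v x y z = (\<chi> i. if i = ix then x else if i = iy then y else if i = iz then z else v $ i)"

lemma upd_nth [simp]:
  "upd v x y z $ ix = x" "upd v x y z $ iy = y" "upd v x y z $ iz = z"
  "i \<noteq> ix \<Longrightarrow> i \<noteq> iy \<Longrightarrow> i \<noteq> iz \<Longrightarrow> upd v x y z $ i = v $ i"
  using distinct by (auto simp: upd_def)

lemma upd_upd [simp]: "upd (upd v x y z) x' y' z' = upd v x' y' z'"
  by (simp add: upd_def vec_eq_iff)

lemma upd_same [simp]: "upd v (v $ ix) (v $ iy) (v $ iz) = v"
  by (simp add: upd_def vec_eq_iff)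

lemma coordinate_cases:
  assumes "Q ix" "Q iy" "Q iz" "\<And>i. i \<noteq> ix \<Longrightarrow> i \<noteq> iy \<Longrightarrow> i \<noteq> iz \<Longrightarrow> Q i"
  shows "Q i"
  using assms by metis

definition P :: "complex poly \<Rightarrow> complex poly \<Rightarrow> nat \<Rightarrow> complex ^ 'n \<Rightarrow> complex" where
  "P f g k v = poly g (v $ iz) * (v $ ix)\<^sup>2 * v $ iy + poly f (v $ iz) +
     v $ ix * poly g (v $ iz) * poly f (v $ iz) ^ k"

definition H :: "complex poly \<Rightarrow> complex poly \<Rightarrow> nat \<Rightarrow> (complex ^ 'n) set" where
  "H f g k = {v. P f g k v = 0}"

lemma polyfun_P: "polyfun (P f g k)"
  unfolding P_def by (intro polyfun_intros)

lemma polyfun_models: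
  assumes "polyfun C" "polyfun A" "polyfun B"
  shows "polyfun (\<lambda>v. to_model (poly g (v $ iz)) (poly f (v $ iz)) k (C v) (A v) (B v))"
    and "polyfun (\<lambda>v. of_model (poly g (v $ iz)) (poly f (v $ iz)) k (C v) (A v) (B v))"
  unfolding to_model_def of_model_def diff_quot_def by (intro polyfun_intros assms)+

text \<open>Both maps preserve the value c of the defining polynomial, so each level set can be
  treated separately, with c as an invertible constant.\<close>

lemma complements_isomorphic: "variety_iso (- H f g k) (- H f g (Suc k))"
proof -
  let ?G = "\<lambda>v. poly g (v $ iz)" and ?F = "\<lambda>v. poly f (v $ iz)"
  let ?T = "\<lambda>k v. to_model (?G v) (?F v) k (P f g k v) (v $ ix) (v $ iy)"
  \<comment> \<open>Pass to the model with \<open>c ^ k\<close>, replace (x, y) by (x / c, c^2 y),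
    and return from the model with \<open>c ^ Suc k\<close>.\<close>
  define \<phi> where "\<phi> v = (let c = P f g k v; x = v $ ix / c in
      upd v x (of_model (?G v) (?F v) (Suc k) c x (c\<^sup>2 * ?T k v)) (v $ iz))" for v
  define \<psi> where "\<psi> v = (let c = P f g (Suc k) v; x = c * v $ ix in
      upd v x (of_model (?G v) (?F v) k c x (?T (Suc k) v / c\<^sup>2)) (v $ iz))" for v
  have \<phi>: "P f g (Suc k) (\<phi> v) = P f g k v" "\<psi> (\<phi> v) = v" if v: "P f g k v \<noteq> 0" for v
  proof -
    define c where "c = P f g k v"
    have c: "c \<noteq> 0" "?G v * (v $ ix)\<^sup>2 * v $ iy + ?F v + v $ ix * ?G v * ?F v ^ k = c"
      using v by (auto simp: c_def P_def)
    note T = to_model[OF c(2)]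
    define x where "x = v $ ix / c"
    have x: "v $ ix = c * x" using c(1) by (simp add: x_def)
    \<comment> \<open>The scaling leaves x^2 y unchanged, and the old x times c^k is the new x times
      c^(k+1).\<close>
    have "?G v * x\<^sup>2 * (c\<^sup>2 * ?T k v) + ?F v + x * ?G v * c ^ Suc k = c"
      using T(1) unfolding c_def[symmetric] x by (simp add: algebra_simps power_mult_distrib)
    note U = of_model[OF this]
    have \<phi>v: "\<phi> v = upd v x (of_model (?G v) (?F v) (Suc k) c x (c\<^sup>2 * ?T k v)) (v $ iz)"
      by (simp add: \<phi>_def c_def x_def Let_def)
    show P\<phi>: "P f g (Suc k) (\<phi> v) = P f g k v"
      unfolding \<phi>v P_def[of f g "Suc k"] using U(1) by (simp add: c_def)
    have "?T (Suc k) (\<phi> v) = c\<^sup>2 * ?T k v"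
      unfolding P\<phi> using U(2) by (simp add: \<phi>v c_def)
    then show "\<psi> (\<phi> v) = v"
      unfolding \<psi>_def P\<phi> Let_def using T(2) c(1) by (simp add: \<phi>v c_def[symmetric] x[symmetric])
  qed
  have \<psi>: "P f g k (\<psi> v) = P f g (Suc k) v" "\<phi> (\<psi> v) = v" if v: "P f g (Suc k) v \<noteq> 0" for v
  proof -
    define c where "c = P f g (Suc k) v"
    have c: "c \<noteq> 0" "?G v * (v $ ix)\<^sup>2 * v $ iy + ?F v + v $ ix * ?G v * ?F v ^ Suc k = c"
      using v by (auto simp: c_def P_def)
    note T = to_model[OF c(2)]
    define x where "x = c * v $ ix"
    have x: "v $ ix = x / c" using c(1) by (simp add: x_def)
    have "?G v * x\<^sup>2 * (?T (Suc k) v / c\<^sup>2) + ?F v + x * ?G v * c ^ k = c"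
      using T(1) c(1) unfolding c_def[symmetric] x by (simp add: field_simps power2_eq_square)
    note U = of_model[OF this]
    have \<psi>v: "\<psi> v = upd v x (of_model (?G v) (?F v) k c x (?T (Suc k) v / c\<^sup>2)) (v $ iz)"
      by (simp add: \<psi>_def c_def x_def Let_def)
    show P\<psi>: "P f g k (\<psi> v) = P f g (Suc k) v"
      unfolding \<psi>v P_def[of f g k] using U(1) by (simp add: c_def)
    have "?T k (\<psi> v) = ?T (Suc k) v / c\<^sup>2"
      unfolding P\<psi> using U(2) by (simp add: \<psi>v c_def)
    then show "\<phi> (\<psi> v) = v"
      unfolding \<phi>_def P\<psi> Let_def using T(2) c(1) by (simp add: \<psi>v c_def[symmetric] x[symmetric])
  qed
  have reg\<phi>: "regular_on (- H f g k) (\<lambda>v. \<phi> v $ i)" for i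
  proof (rule coordinate_cases[of _ i])
    show "regular_on (- H f g k) (\<lambda>v. \<phi> v $ ix)"
      by (rule regular_on_quotient[of "\<lambda>v. v $ ix" "P f g k"])
         (auto simp: \<phi>_def Let_def H_def intro: polyfun.coord polyfun_P)
    \<comment> \<open>Although x is divided by c, this coordinate is polynomial: x enters only
      through its product with c^2 \<open>?T k v\<close>.\<close>
    show "regular_on (- H f g k) (\<lambda>v. \<phi> v $ iy)"
    proof (rule regular_on_quotient[of "\<lambda>v. (P f g k v)\<^sup>2 * ?T k v + ?G v *
        (P f g k v * v $ ix * ?T k v + P f g k v ^ Suc k) * diff_quot (Suc k) (?F v) (P f g k v)" "\<lambda>_. 1"])
      show "polyfun (\<lambda>v. (P f g k v)\<^sup>2 * ?T k v + ?G v *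
        (P f g k v * v $ ix * ?T k v + P f g k v ^ Suc k) * diff_quot (Suc k) (?F v) (P f g k v))"
        unfolding diff_quot_def by (intro polyfun_intros polyfun_P polyfun_models)
      fix v assume "v \<in> - H f g k"
      then have "P f g k v \<noteq> 0" by (simp add: H_def)
      then show "1 \<noteq> (0::complex) \<and> \<phi> v $ iy = ((P f g k v)\<^sup>2 * ?T k v + ?G v *
        (P f g k v * v $ ix * ?T k v + P f g k v ^ Suc k) * diff_quot (Suc k) (?F v) (P f g k v)) / 1"
        by (simp add: \<phi>_def Let_def of_model_def power2_eq_square)
    qed (rule polyfun.const)
  qed (auto simp: \<phi>_def Let_def intro!: regular_on_polyfun polyfun.coord)
  have reg\<psi>: "regular_on (- H f g (Suc k)) (\<lambda>v. \<psi> v $ i)" for i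
  proof (rule coordinate_cases[of _ i])
    show "regular_on (- H f g (Suc k)) (\<lambda>v. \<psi> v $ ix)"
      by (auto simp: \<psi>_def Let_def intro!: regular_on_polyfun polyfun_intros polyfun_P)
    \<comment> \<open>Here c^2 is a common denominator, which turns the summand c^k into
      c^(k+2).\<close>
    show "regular_on (- H f g (Suc k)) (\<lambda>v. \<psi> v $ iy)"
    proof (rule regular_on_quotient[of "\<lambda>v. ?T (Suc k) v + ?G v *
        (P f g (Suc k) v * v $ ix * ?T (Suc k) v + P f g (Suc k) v ^ (k + 2)) * diff_quot k (?F v) (P f g (Suc k) v)"
        "\<lambda>v. (P f g (Suc k) v)\<^sup>2"])
      show "polyfun (\<lambda>v. ?T (Suc k) v + ?G v *
        (P f g (Suc k) v * v $ ix * ?T (Suc k) v + P f g (Suc k) v ^ (k + 2)) * diff_quot k (?F v) (P f g (Suc k) v))"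
        unfolding diff_quot_def by (intro polyfun_intros polyfun_P polyfun_models)
      fix v assume "v \<in> - H f g (Suc k)"
      then have "P f g (Suc k) v \<noteq> 0" by (simp add: H_def)
      then show "(P f g (Suc k) v)\<^sup>2 \<noteq> 0 \<and> \<psi> v $ iy = (?T (Suc k) v + ?G v *
        (P f g (Suc k) v * v $ ix * ?T (Suc k) v + P f g (Suc k) v ^ (k + 2)) * diff_quot k (?F v) (P f g (Suc k) v)) / (P f g (Suc k) v)\<^sup>2"
        by (simp add: \<psi>_def Let_def of_model_def field_simps power2_eq_square)
    qed (intro polyfun_intros polyfun_P)
  qed (auto simp: \<psi>_def Let_def intro!: regular_on_polyfun polyfun.coord)
  show ?thesis
    unfolding variety_iso_def regular_map_def
    using \<phi> \<psi> reg\<phi> reg\<psi> by - (rule exI[of _ \<phi>], rule exI[of _ \<psi>], auto simp: H_def, metis+)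
qed

text \<open>At level 0 the model term with 0^k vanishes for k > 0, so both hypersurfaces share the
  model g x^2 y + f = 0. For k = 0 this breaks down, as 0^0 = 1.\<close>

lemma H_isomorphic:
  assumes "k > 0" "l > 0"
  shows "variety_iso (H f g k) (H f g l)"
proof -
  let ?G = "\<lambda>v. poly g (v $ iz)" and ?F = "\<lambda>v. poly f (v $ iz)"
  define \<phi> where "\<phi> k l v = upd v (v $ ix) (of_model (?G v) (?F v) l 0 (v $ ix)
      (to_model (?G v) (?F v) k 0 (v $ ix) (v $ iy))) (v $ iz)" for k l v
  have \<phi>: "P f g l (\<phi> k l v) = 0 \<and> \<phi> l k (\<phi> k l v) = v"
    if kl: "k > 0" "l > 0" and v: "P f g k v = 0" for k l v
  proof -
    have "?G v * (v $ ix)\<^sup>2 * v $ iy + ?F v + v $ ix * ?G v * ?F v ^ k = 0"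
      using v by (auto simp: P_def)
    note T = to_model[OF this]
    from T(1) have "?G v * (v $ ix)\<^sup>2 * to_model (?G v) (?F v) k 0 (v $ ix) (v $ iy) + ?F v +
        v $ ix * ?G v * 0 ^ l = 0"
      using kl by (simp add: power_0_left)
    note U = of_model[OF this]
    show ?thesis using U T(2) by (simp add: \<phi>_def P_def)
  qed
  have reg: "regular_on X (\<lambda>v. \<phi> k l v $ i)" for X k l i
    by (rule coordinate_cases[of _ i])
       (auto simp: \<phi>_def intro!: regular_on_polyfun polyfun_models polyfun_intros)
  show ?thesis
    unfolding variety_iso_def regular_map_def
    using \<phi> reg assms by - (rule exI[of _ "\<phi> k l"], rule exI[of _ "\<phi> l k"], auto simp: H_def)
qed

section \<open>Irreducibility and smoothness criteria for the family\<close>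

lemma hypersurface_H:
  assumes "g \<noteq> 0"
  shows "hypersurface (H f g k)"
proof -
  obtain z where "poly g z \<noteq> 0" using assms poly_all_0_iff_0 by blast
  then have "P f g k (upd 0 1 0 z) \<noteq> P f g k (upd 0 1 1 z)" by (simp add: P_def)
  then show ?thesis unfolding H_def by (rule hypersurface_polyfun[OF polyfun_P])
qed

text \<open>Where x and g(z) are nonzero the equation is linear in y with invertible leading
  coefficient, so the part x \<noteq> 0 is a graph y = B / D over a principal open set.\<close>

lemma irreducible_H:
  assumes "g \<noteq> 0" and g: "\<And>v. v \<in> H f g k \<Longrightarrow> poly g (v $ iz) \<noteq> 0"
    and dense: "H f g k \<subseteq> closure {v \<in> H f g k. v $ ix \<noteq> 0}"
  shows "irreducible_hypersurface (H f g k)"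
proof -
  let ?G = "\<lambda>v. poly g (v $ iz)" and ?F = "\<lambda>v. poly f (v $ iz)"
  define D where "D v = ?G v * (v $ ix)\<^sup>2" for v
  define B where "B v = - (?F v + v $ ix * ?G v * ?F v ^ k)" for v
  define E where "E v = (\<chi> i. if i = iy then B v else v $ i * D v)" for v
  define \<Psi> where "\<Psi> v = upd v (v $ ix) (B v / D v) (v $ iz)" for v
  have P: "P f g k v = D v * v $ iy - B v" for v
    by (simp add: P_def B_def D_def algebra_simps)
  have DB: "D (upd v (v $ ix) y (v $ iz)) = D v" "B (upd v (v $ ix) y (v $ iz)) = B v" for v y
    by (simp_all add: D_def B_def)
  obtain z where z: "poly g z \<noteq> 0" using assms(1) poly_all_0_iff_0 by blast
  have \<Psi>H: "\<Psi> v \<in> H f g k" if "D v \<noteq> 0" for v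
    using that by (simp add: H_def P \<Psi>_def DB)
  have "zariski_irreducible (H f g k)"
  proof (rule zariski_irreducibleI[of D "upd 0 1 0 z" E \<Psi>])
    show "polyfun D" unfolding D_def by (intro polyfun_intros)
    show "polyfun (\<lambda>v. E v $ i)" for i
      by (cases "i = iy") (auto simp: E_def B_def D_def intro!: polyfun_intros)
    show "\<Psi> v $ i = E v $ i / D v" if "D v \<noteq> 0" for v i
      by (rule coordinate_cases[of _ i]) (use that distinct in \<open>auto simp: \<Psi>_def E_def\<close>)
    have "v \<in> \<Psi> ` {v. D v \<noteq> 0}" if v: "v \<in> H f g k" "v $ ix \<noteq> 0" for v
    proof
      show D: "v \<in> {v. D v \<noteq> 0}" using g[OF v(1)] v(2) by (simp add: D_def)
      then have "B v / D v = v $ iy" using v(1) by (simp add: H_def P field_simps)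
      then show "v = \<Psi> v" by (simp add: \<Psi>_def)
    qed
    then have "{v \<in> H f g k. v $ ix \<noteq> 0} \<subseteq> \<Psi> ` {v. D v \<noteq> 0}" by blast
    then show "H f g k \<subseteq> closure (\<Psi> ` {v. D v \<noteq> 0})" using dense closure_mono by blast
  qed (use z \<Psi>H in \<open>auto simp: D_def\<close>)
  then show ?thesis using hypersurface_H assms(1) by (simp add: irreducible_hypersurface_def)
qed

text \<open>The formal derivatives are identified through uniqueness of derivatives along the
  coordinate axes. For x = 0 the polynomial restricts to f in the z-direction.\<close>

lemma partial_deriv_P:
  assumes p: "\<And>v. P f g k v = poly_eval p v"
  shows "poly_eval (partial_deriv ix p) v =
      2 * poly g (v $ iz) * v $ ix * v $ iy + poly g (v $ iz) * poly f (v $ iz) ^ k" (is ?x)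
    and "poly_eval (partial_deriv iy p) v = poly g (v $ iz) * (v $ ix)\<^sup>2" (is ?y)
    and "v $ ix = 0 \<Longrightarrow> poly_eval (partial_deriv iz p) v = poly (pderiv f) (v $ iz)" (is "_ \<Longrightarrow> ?z")
proof -
  have sum_axis: "(\<Sum>i\<in>UNIV. h i * axis l (1::complex) $ i) = h l" for h :: "'n \<Rightarrow> complex" and l
    by (simp add: axis_def if_distrib cong: if_cong)
  have d: "((\<lambda>t. P f g k (\<gamma> t)) has_field_derivative poly_eval (partial_deriv l p) (\<gamma> 0)) (at 0)"
    if "\<And>i. ((\<lambda>t. \<gamma> t $ i) has_field_derivative axis l 1 $ i) (at 0)" for \<gamma> :: "complex \<Rightarrow> complex ^ 'n" and l
    using poly_eval_curve_derivative[of \<gamma> "axis l 1" 0 p] that by (simp add: sum_axis p)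
  have "((\<lambda>t. P f g k (upd v (v $ ix + t) (v $ iy) (v $ iz))) has_field_derivative
     poly_eval (partial_deriv ix p) v) (at 0)"
  proof (rule d[of "\<lambda>t. upd v (v $ ix + t) (v $ iy) (v $ iz)" ix, simplified])
    show "((\<lambda>t. upd v (v $ ix + t) (v $ iy) (v $ iz) $ i) has_field_derivative axis ix 1 $ i) (at 0)" for i
      by (rule coordinate_cases[of _ i]) (use distinct in \<open>auto simp: axis_def intro!: derivative_eq_intros\<close>)
  qed
  then show ?x unfolding P_def
    by (rule DERIV_unique) (auto intro!: derivative_eq_intros simp: algebra_simps)
  have "((\<lambda>t. P f g k (upd v (v $ ix) (v $ iy + t) (v $ iz))) has_field_derivative
     poly_eval (partial_deriv iy p) v) (at 0)"
  proof (rule d[of "\<lambda>t. upd v (v $ ix) (v $ iy + t) (v $ iz)" iy, simplified])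
    show "((\<lambda>t. upd v (v $ ix) (v $ iy + t) (v $ iz) $ i) has_field_derivative axis iy 1 $ i) (at 0)" for i
      by (rule coordinate_cases[of _ i]) (use distinct in \<open>auto simp: axis_def intro!: derivative_eq_intros\<close>)
  qed
  then show ?y unfolding P_def
    by (rule DERIV_unique) (auto intro!: derivative_eq_intros simp: algebra_simps)
  have "((\<lambda>t. P f g k (upd v (v $ ix) (v $ iy) (v $ iz + t))) has_field_derivative
     poly_eval (partial_deriv iz p) v) (at 0)"
  proof (rule d[of "\<lambda>t. upd v (v $ ix) (v $ iy) (v $ iz + t)" iz, simplified])
    show "((\<lambda>t. upd v (v $ ix) (v $ iy) (v $ iz + t) $ i) has_field_derivative axis iz 1 $ i) (at 0)" for i
      by (rule coordinate_cases[of _ i]) (use distinct in \<open>auto simp: axis_def intro!: derivative_eq_intros\<close>)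
  qed
  moreover assume "v $ ix = 0"
  ultimately have "((\<lambda>t. poly f (v $ iz + t)) has_field_derivative
     poly_eval (partial_deriv iz p) v) (at 0)" by (simp add: P_def)
  then show ?z
    by (rule DERIV_unique) (auto intro!: derivative_eq_intros DERIV_chain2[of "poly f"] poly_DERIV)
qed

text \<open>Where x \<noteq> 0 the y-derivative g x^2 is nonzero. Where x = 0 the equation gives f =
  0, and then the x-derivative g f^k (if k = 0) or the z-derivative f' is nonzero.\<close>

lemma smooth_H:
  assumes "g \<noteq> 0" and g: "\<And>v. v \<in> H f g k \<Longrightarrow> poly g (v $ iz) \<noteq> 0"
    and dense: "H f g k \<subseteq> closure {v \<in> H f g k. v $ ix \<noteq> 0}"
    and f: "k = 0 \<or> (\<forall>z. poly f z = 0 \<longrightarrow> poly (pderiv f) z \<noteq> 0)"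
  shows "smooth_hypersurface (H f g k)"
proof -
  obtain p where p: "\<And>v. P f g k v = poly_eval p v" using polyfun_imp_poly_eval[OF polyfun_P] by blast
  have H: "H f g k = {v. poly_eval p v = 0}" by (simp add: H_def p)
  note pd = partial_deriv_P[OF p]
  show ?thesis unfolding H
  proof (rule smooth_hypersurfaceI[where l = iy])
    obtain z where "poly g z \<noteq> 0" using assms(1) poly_all_0_iff_0 by blast
    then have "P f g k (upd 0 1 0 z) \<noteq> P f g k (upd 0 1 1 z)" by (simp add: P_def)
    then show "nonconstant p" unfolding p by (rule nonconstantI)
    show "\<exists>i. poly_eval (partial_deriv i p) a \<noteq> 0" if a: "a \<in> {v. poly_eval p v = 0}" for a
    proof -
      have aH: "a \<in> H f g k" using a by (simp add: H)
      show ?thesis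
      proof (cases "a $ ix = 0")
        case True
        then have "poly f (a $ iz) = 0" using aH by (simp add: H_def P_def)
        then have "poly_eval (partial_deriv ix p) a \<noteq> 0 \<or> poly_eval (partial_deriv iz p) a \<noteq> 0"
          using f True g[OF aH] by (auto simp: pd)
        then show ?thesis by blast
      next
        case False
        then show ?thesis using g[OF aH] by (intro exI[of _ iy]) (simp add: pd)
      qed
    qed
    show "{v \<in> H f g k. v $ ix \<noteq> 0} \<subseteq> {v. poly_eval p v = 0}" by (auto simp: H)
    show "{v. poly_eval p v = 0} \<subseteq> closure {v \<in> H f g k. v $ ix \<noteq> 0}" using dense by (simp add: H)
    fix a assume "a \<in> {v \<in> H f g k. v $ ix \<noteq> 0}"
    then have a: "a \<in> H f g k" "a $ ix \<noteq> 0" "poly g (a $ iz) \<noteq> 0" using g by auto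
    show "poly_eval (partial_deriv iy p) a \<noteq> 0 \<and>
      (\<forall>v. \<exists>\<gamma> d. \<gamma> 0 = a \<and> (\<forall>i. ((\<lambda>t. \<gamma> t $ i) has_field_derivative d $ i) (at 0)) \<and>
         (\<forall>i. i \<noteq> iy \<longrightarrow> d $ i = v $ i) \<and> (\<forall>\<^sub>F t in nhds 0. \<gamma> t \<in> {v. poly_eval p v = 0}))"
    proof (intro conjI allI)
      show "poly_eval (partial_deriv iy p) a \<noteq> 0" using a by (simp add: pd)
      fix v :: "complex ^ 'n"
      let ?x = "\<lambda>t. a $ ix + t * v $ ix" and ?z = "\<lambda>t. a $ iz + t * v $ iz"
      let ?D = "\<lambda>t. poly g (?z t) * (?x t)\<^sup>2"
      let ?B = "\<lambda>t. - (poly f (?z t) + ?x t * poly g (?z t) * poly f (?z t) ^ k)"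
      \<comment> \<open>Move linearly in all coordinates except y and solve the equation for y; this
        realises any prescribed velocity outside \<open>iy\<close>.\<close>
      define \<gamma> where "\<gamma> t = upd (\<chi> i. a $ i + t * v $ i) (?x t) (?B t / ?D t) (?z t)" for t
      have D0: "?D 0 \<noteq> 0" using a by simp
      have diff: "(\<lambda>t. ?B t / ?D t) field_differentiable at 0"
      proof -
        have "(\<lambda>t. poly h (?z t)) field_differentiable at 0" for h
          unfolding field_differentiable_def
          by (rule exI, rule DERIV_chain2[of "poly h"], rule poly_DERIV) (auto intro!: derivative_eq_intros)
        then show ?thesis
          using D0 by (intro field_differentiable_divide field_differentiable_minus field_differentiable_add
            field_differentiable_mult field_differentiable_power field_differentiable_const field_differentiable_ident) auto
      qed
      then obtain y' where y': "((\<lambda>t. ?B t / ?D t) has_field_derivative y') (at 0)"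
        unfolding field_differentiable_def by blast
      define d where "d = upd v (v $ ix) y' (v $ iz)"
      have "?B 0 = a $ iy * ?D 0 - P f g k a" by (simp add: P_def algebra_simps)
      then have "?B 0 = a $ iy * ?D 0" using a(1) by (simp add: H_def)
      then have "?B 0 / ?D 0 = a $ iy" using D0 by simp
      then have "\<gamma> 0 = a" by (simp add: \<gamma>_def vec_eq_iff upd_def)
      moreover have "((\<lambda>t. \<gamma> t $ i) has_field_derivative d $ i) (at 0)" for i
        by (rule coordinate_cases[of _ i]) (use y' in \<open>auto simp: \<gamma>_def d_def intro!: derivative_eq_intros\<close>)
      moreover have "\<forall>i. i \<noteq> iy \<longrightarrow> d $ i = v $ i" by (simp add: d_def upd_def)
      moreover have "\<forall>\<^sub>F t in nhds 0. \<gamma> t \<in> {v. poly_eval p v = 0}"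
      proof -
        have "isCont ?D 0" by (intro continuous_intros)
        then have "\<forall>\<^sub>F t in nhds 0. ?D t \<noteq> 0"
          using D0 by (intro tendsto_imp_eventually_ne[of _ "?D 0"]) (auto simp: continuous_at tendsto_nhds_iff)
        then show ?thesis
          by eventually_elim (simp add: \<gamma>_def P_def divide_simps flip: p)
      qed
      ultimately show "\<exists>\<gamma> d. \<gamma> 0 = a \<and> (\<forall>i. ((\<lambda>t. \<gamma> t $ i) has_field_derivative d $ i) (at 0)) \<and>
         (\<forall>i. i \<noteq> iy \<longrightarrow> d $ i = v $ i) \<and> (\<forall>\<^sub>F t in nhds 0. \<gamma> t \<in> {v. poly_eval p v = 0})"
        by blast
    qed
  qed
qed

lemma dense_by_curves:
  assumes "\<And>v. v \<in> H f g k \<Longrightarrow> v $ ix = 0 \<Longrightarrow> \<exists>x y z. (x \<longlongrightarrow> v $ ix) (at 0) \<and>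
      (y \<longlongrightarrow> v $ iy) (at 0) \<and> (z \<longlongrightarrow> v $ iz) (at 0) \<and>
      (\<forall>\<^sub>F t in at (0::complex). upd v (x t) (y t) (z t) \<in> H f g k \<and> x t \<noteq> 0)"
  shows "H f g k \<subseteq> closure {v \<in> H f g k. v $ ix \<noteq> 0}"
proof
  fix v assume v: "v \<in> H f g k"
  let ?G = "{v \<in> H f g k. v $ ix \<noteq> 0}"
  show "v \<in> closure ?G"
  proof (cases "v $ ix = 0")
    case False
    then show ?thesis using v closure_subset[of ?G] by blast
  next
    case True
    then obtain x y z where xyz: "(x \<longlongrightarrow> v $ ix) (at 0)" "(y \<longlongrightarrow> v $ iy) (at 0)" "(z \<longlongrightarrow> v $ iz) (at 0)"
      "\<forall>\<^sub>F t in at (0::complex). upd v (x t) (y t) (z t) \<in> H f g k \<and> x t \<noteq> 0"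
      using assms[OF v] by blast
    have "((\<lambda>t. upd v (x t) (y t) (z t)) \<longlongrightarrow> v) (at 0)"
    proof (rule vec_tendstoI)
      show "((\<lambda>t. upd v (x t) (y t) (z t) $ i) \<longlongrightarrow> v $ i) (at 0)" for i
        by (rule coordinate_cases[of _ i]) (use xyz in auto)
    qed
    moreover have "\<forall>\<^sub>F t in at (0::complex). upd v (x t) (y t) (z t) \<in> closure ?G"
      using xyz(4) by eventually_elim (rule set_mp[OF closure_subset], simp)
    ultimately show ?thesis
      by (intro Lim_in_closed_set[of "closure ?G"]) auto
  qed
qed

section \<open>A smooth and a singular hypersurface\<close>

lemma P_quadratic: "P [:0, 0, 1:] 1 k v = (v $ ix)\<^sup>2 * v $ iy + (v $ iz)\<^sup>2 + v $ ix * ((v $ iz)\<^sup>2) ^ k"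
  by (simp add: P_def power2_eq_square)

lemma dense_quadratic:
  assumes "k \<le> 1"
  shows "H [:0, 0, 1:] 1 k \<subseteq> closure {v \<in> H [:0, 0, 1:] 1 k. v $ ix \<noteq> 0}"
proof (rule dense_by_curves)
  fix v assume "v \<in> H [:0, 0, 1:] 1 k" and x: "v $ ix = 0"
  then have z: "v $ iz = 0" by (simp add: H_def P_quadratic)
  let ?y = "v $ iy"
  have ev: "\<forall>\<^sub>F t in at (0::complex). t \<noteq> 0" by (simp add: eventually_at_filter)
  have "k = 0 \<or> k = 1" using assms by auto
  then show "\<exists>x y z. (x \<longlongrightarrow> v $ ix) (at 0) \<and> (y \<longlongrightarrow> v $ iy) (at 0) \<and> (z \<longlongrightarrow> v $ iz) (at 0) \<and>
      (\<forall>\<^sub>F t in at (0::complex). upd v (x t) (y t) (z t) \<in> H [:0, 0, 1:] 1 k \<and> x t \<noteq> 0)"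
  proof
    assume k: "k = 0"
    \<comment> \<open>With y0 the given y-coordinate, put z = t and demand x^2 y = t^4 y0; the
      equation then forces x = - t^2 (1 + y0 t^2).\<close>
    let ?s = "\<lambda>t::complex. 1 + ?y * t\<^sup>2"
    have "(?s \<longlongrightarrow> 1) (at 0)" by (auto intro!: tendsto_eq_intros)
    then have ev1: "\<forall>\<^sub>F t in at 0. ?s t \<noteq> 0" by (rule tendsto_imp_eventually_ne) simp
    have "\<forall>\<^sub>F t in at (0::complex). upd v (- t\<^sup>2 * ?s t) (?y / (?s t)\<^sup>2) t \<in> H [:0, 0, 1:] 1 k
        \<and> - t\<^sup>2 * ?s t \<noteq> 0"
      using ev ev1
    proof eventually_elim
      case (elim t)
      have "(- t\<^sup>2 * ?s t)\<^sup>2 * (?y / (?s t)\<^sup>2) = t ^ 4 * ?y"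
        using elim(2) by (simp add: power_mult_distrib)
      moreover have "P [:0, 0, 1:] 1 k (upd v (- t\<^sup>2 * ?s t) (?y / (?s t)\<^sup>2) t) =
          (- t\<^sup>2 * ?s t)\<^sup>2 * (?y / (?s t)\<^sup>2) + t\<^sup>2 - t\<^sup>2 * ?s t"
        by (simp add: P_quadratic k)
      moreover have "t ^ 4 * ?y + t\<^sup>2 - t\<^sup>2 * ?s t = 0"
        by (simp add: algebra_simps power4_eq_xxxx power2_eq_square)
      ultimately show ?case using elim by (simp add: H_def)
    qed
    moreover have "((\<lambda>t. - t\<^sup>2 * ?s t) \<longlongrightarrow> v $ ix) (at 0)" "((\<lambda>t. ?y / (?s t)\<^sup>2) \<longlongrightarrow> v $ iy) (at 0)"
      "((\<lambda>t. t) \<longlongrightarrow> v $ iz) (at 0)"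
      unfolding x z by (auto intro!: tendsto_eq_intros)
    ultimately show ?thesis by blast
  next
    assume k: "k = 1"
    \<comment> \<open>With x = t and z = e t the equation becomes y = - e^2 (1 + t), so e^2 = - y0
      gives the right limit.\<close>
    let ?e = "csqrt (- ?y)"
    have "\<forall>\<^sub>F t in at (0::complex). upd v t (?y * (1 + t)) (?e * t) \<in> H [:0, 0, 1:] 1 k \<and> t \<noteq> 0"
      using ev by eventually_elim (simp add: H_def P_quadratic k power_mult_distrib algebra_simps)
    moreover have "((\<lambda>t. t) \<longlongrightarrow> v $ ix) (at 0)" "((\<lambda>t. ?y * (1 + t)) \<longlongrightarrow> v $ iy) (at 0)"
      "((\<lambda>t. ?e * t) \<longlongrightarrow> v $ iz) (at 0)"
      unfolding x z by (auto intro!: tendsto_eq_intros)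
    ultimately show ?thesis by blast
  qed
qed

text \<open>At x = z = 0, y = -1 the equation z^2 (1 + x) = - x^2 y has two branches, z ~ x and z ~
  -x. Velocities of curves inside the hypersurface span the whole space there, so every differential
  of the ideal vanishes.\<close>

lemma singular_quadratic: "singular_hypersurface (H [:0, 0, 1:] 1 1)"
proof -
  let ?H = "H [:0, 0, 1:] 1 1"
  define a where "a = upd 0 0 (-1) 0"
  have a: "a \<in> ?H" by (simp add: a_def H_def P_quadratic)
  let ?L = "\<lambda>p i. poly_eval (partial_deriv i p) a"
  have sum_axis: "(\<Sum>i\<in>UNIV. h i * axis l (1::complex) $ i) = h l" for h :: "'n \<Rightarrow> complex" and l
    by (simp add: axis_def if_distrib cong: if_cong)
  \<comment> \<open>The locus x = z = 0 lies in the hypersurface, so all other coordinate axes are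
    tangent.\<close>
  have ax: "?L p l = 0" if p: "p \<in> vanishing_ideal ?H" and l: "l \<noteq> ix" "l \<noteq> iz" for p l
  proof -
    have "axis l 1 \<in> tangent_space ?H ((\<lambda>t. \<chi> i. a $ i + t * axis l 1 $ i) 0)"
    proof (rule tangent_space_velocity)
      show "\<forall>\<^sub>F t in nhds 0. (\<chi> i. a $ i + t * axis l 1 $ i) \<in> ?H"
        using l distinct by (auto simp: H_def P_quadratic a_def axis_def)
    qed (auto intro!: derivative_eq_intros)
    then show ?thesis using p by (simp add: tangent_space_def sum_axis)
  qed
  \<comment> \<open>The curve x = t, y = - (1 + t), z = s t lies on the hypersurface exactly for s^2
    = 1; the signs give the two branches.\<close>
  have xz: "?L p ix + s * ?L p iz = 0" if p: "p \<in> vanishing_ideal ?H" and s: "s\<^sup>2 = 1" for p s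
  proof -
    let ?d = "upd 0 1 (-1) s"
    have "?d \<in> tangent_space ?H ((\<lambda>t. upd 0 t (- (1 + t)) (s * t)) 0)"
    proof (rule tangent_space_velocity)
      show "((\<lambda>t. upd 0 t (- (1 + t)) (s * t) $ i) has_field_derivative ?d $ i) (at 0)" for i
        by (rule coordinate_cases[of _ i]) (auto intro!: derivative_eq_intros)
      have "upd 0 t (- (1 + t)) (s * t) \<in> ?H" for t
        using s by (simp add: H_def P_quadratic power_mult_distrib algebra_simps)
      then show "\<forall>\<^sub>F t in nhds 0. upd 0 t (- (1 + t)) (s * t) \<in> ?H" by simp
    qed
    then have "(\<Sum>i\<in>UNIV. ?L p i * ?d $ i) = 0" using p by (simp add: tangent_space_def a_def)
    moreover have d: "?d = axis ix 1 - axis iy 1 + s *s axis iz 1"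
      unfolding vec_eq_iff
      by (rule allI, rule coordinate_cases) (use distinct in \<open>auto simp: axis_def\<close>)
    have "(\<Sum>i\<in>UNIV. ?L p i * ?d $ i) =
       (\<Sum>i\<in>UNIV. ?L p i * axis ix 1 $ i) - (\<Sum>i\<in>UNIV. ?L p i * axis iy 1 $ i) +
        s * (\<Sum>i\<in>UNIV. ?L p i * axis iz 1 $ i)"
      unfolding d by (simp add: right_diff_distrib distrib_left sum.distrib sum_subtractf
        sum_distrib_left mult.left_commute)
    ultimately show ?thesis using ax[OF p, of iy] distinct by (simp add: sum_axis)
  qed
  have "?L p i = 0" if p: "p \<in> vanishing_ideal ?H" for p i
  proof -
    have "?L p ix + ?L p iz = 0" "?L p ix - ?L p iz = 0" using xz[OF p, of 1] xz[OF p, of "-1"] by simp_all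
    then have "?L p ix = 0" "?L p iz = 0" by (simp_all add: eq_neg_iff_add_eq_0[symmetric])
    then show ?thesis using ax[OF p] by metis
  qed
  then have "tangent_space ?H a = UNIV" by (auto simp: tangent_space_def)
  then have "vec.dim (tangent_space ?H a) = CARD('n)" by (simp only: vec_dim_card)
  then have "vec.dim (tangent_space ?H a) \<noteq> CARD('n) - 1"
    using zero_less_card_finite[where 'a = 'n] by linarith
  then show ?thesis using a hypersurface_H unfolding singular_hypersurface_def by (meson one_neq_zero)
qed

lemma smooth_and_singular_isomorphic_complements:
  "\<exists>(H1 :: (complex ^ 'n) set) (H2 :: (complex ^ 'n) set).
     irreducible_hypersurface H1 \<and> irreducible_hypersurface H2 \<and>
     variety_iso (- H1) (- H2) \<and> smooth_hypersurface H1 \<and> singular_hypersurface H2"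
proof (rule exI[of _ "H [:0, 0, 1:] 1 0"], rule exI[of _ "H [:0, 0, 1:] 1 1"], intro conjI)
  show "irreducible_hypersurface (H [:0, 0, 1:] 1 0)" "irreducible_hypersurface (H [:0, 0, 1:] 1 1)"
    by (auto intro!: irreducible_H dense_quadratic)
  show "variety_iso (- H [:0, 0, 1:] 1 0) (- H [:0, 0, 1:] 1 1)"
    using complements_isomorphic[of _ _ 0] by simp
  show "smooth_hypersurface (H [:0, 0, 1:] 1 0)"
    by (auto intro!: smooth_H dense_quadratic)
qed (rule singular_quadratic)

section \<open>The hypersurfaces \<open>z (1 + x (z - 1) ^ k + x\<^sup>2 y) = 1\<close>\<close>

abbreviation "Q \<equiv> P [:-1, 1:] [:0, 1:]"
abbreviation "HQ \<equiv> H [:-1, 1:] [:0, 1:]"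

lemma Q_eq: "Q k v = v $ iz * (1 + v $ ix * (v $ iz - 1) ^ k + (v $ ix)\<^sup>2 * v $ iy) - 1"
  by (simp add: P_def algebra_simps)

lemma HQ_z: "v \<in> HQ k \<Longrightarrow> v $ iz \<noteq> 0"
  by (auto simp: H_def Q_eq)

text \<open>The curve is the image under \<open>of_model\<close> of the line \<open>x = t, y = y'\<close> in the model.\<close>

lemma level_set_curve:
  assumes v: "Q k v = c" "v $ ix = 0"
  shows "\<exists>y z. (y \<longlongrightarrow> v $ iy) (at 0) \<and> (z \<longlongrightarrow> v $ iz) (at 0) \<and>
      (\<forall>\<^sub>F t in at (0::complex). Q k (upd v t (y t) (z t)) = c)"
proof -
  have z: "v $ iz = 1 + c" using v by (auto simp: Q_eq)
  \<comment> \<open>The y-coordinate of \<open>v\<close> in the model, given by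
    \<open>to_model\<close>: since x = 0, here z = 1 + c and f(z) = c.\<close>
  define y' where "y' = v $ iy - (1 + c) * c ^ k * diff_quot k c c"
  define s where "s t = 1 + t * c ^ k + t\<^sup>2 * y'" for t
  define z' where "z' t = (1 + c) / s t" for t
  define y where "y t = y' + (1 + c) * (c ^ k + t * y') / s t * diff_quot k c (z' t - 1)" for t
  have s: "(s \<longlongrightarrow> 1) (at 0)" unfolding s_def by (auto intro!: tendsto_eq_intros)
  then have ev: "\<forall>\<^sub>F t in at 0. s t \<noteq> 0" by (rule tendsto_imp_eventually_ne) simp
  have z': "(z' \<longlongrightarrow> 1 + c) (at 0)" unfolding z'_def by (rule tendsto_eq_intros s | simp)+
  have dq: "((\<lambda>t. diff_quot k c (z' t - 1)) \<longlongrightarrow> diff_quot k c (1 + c - 1)) (at 0)"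
    unfolding diff_quot_def by (intro tendsto_intros z')
  have "(y \<longlongrightarrow> y' + (1 + c) * (c ^ k + 0 * y') / 1 * diff_quot k c (1 + c - 1)) (at 0)"
    unfolding y_def by (intro tendsto_intros s dq) simp
  then have "(y \<longlongrightarrow> v $ iy) (at 0)" by (simp add: y'_def)
  moreover have "\<forall>\<^sub>F t in at (0::complex). Q k (upd v t (y t) (z' t)) = c"
    using ev
  proof eventually_elim
    case (elim t)
    \<comment> \<open>The divisibility of f(z) - c by x on the level set, which lets the difference
      of k-th powers be absorbed into y.\<close>
    have "c - (z' t - 1) = t * ((1 + c) * (c ^ k + t * y') / s t)"
      using elim unfolding z'_def by (simp add: field_simps) (simp add: s_def algebra_simps power2_eq_square)
    then have "t * (t * (y t - y')) = t * (c ^ k - (z' t - 1) ^ k)"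
      unfolding diff_quot[of c k "z' t - 1"] by (simp add: y_def)
    then have "1 + t * (z' t - 1) ^ k + t\<^sup>2 * y t = s t"
      by (simp add: s_def algebra_simps power2_eq_square)
    then show ?case using elim by (simp add: Q_eq z'_def)
  qed
  ultimately show ?thesis using z' z by auto
qed

lemma dense_HQ: "HQ k \<subseteq> closure {v \<in> HQ k. v $ ix \<noteq> 0}"
proof (rule dense_by_curves)
  fix v assume "v \<in> HQ k" and x: "v $ ix = 0"
  then obtain y z where yz: "(y \<longlongrightarrow> v $ iy) (at 0)" "(z \<longlongrightarrow> v $ iz) (at 0)"
     "\<forall>\<^sub>F t in at (0::complex). Q k (upd v t (y t) (z t)) = 0"
    using level_set_curve[of k v 0] by (auto simp: H_def)
  have "\<forall>\<^sub>F t in at (0::complex). t \<noteq> 0" by (simp add: eventually_at_filter)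
  with yz(3) have "\<forall>\<^sub>F t in at (0::complex). upd v t (y t) (z t) \<in> HQ k \<and> t \<noteq> 0"
    by eventually_elim (simp add: H_def)
  then show "\<exists>x y z. (x \<longlongrightarrow> v $ ix) (at 0) \<and> (y \<longlongrightarrow> v $ iy) (at 0) \<and> (z \<longlongrightarrow> v $ iz) (at 0) \<and>
      (\<forall>\<^sub>F t in at (0::complex). upd v (x t) (y t) (z t) \<in> HQ k \<and> x t \<noteq> 0)"
    using yz(1,2) x by (intro exI[of _ "\<lambda>t. t"] exI[of _ y] exI[of _ z]) auto
qed

lemma irreducible_HQ: "irreducible_hypersurface (HQ k)"
  by (intro irreducible_H dense_HQ) (use HQ_z in auto)

lemma smooth_HQ: "smooth_hypersurface (HQ k)"
  by (intro smooth_H dense_HQ) (use HQ_z in \<open>auto simp: pderiv_pCons\<close>)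

end

section \<open>Units on the level sets\<close>

text \<open>A priori the exponent n(x) of z depends on x. Comparing z = 1 with z = 2 gives 2^n(x) as
  a constant times x^b; being a positive real for every x, this forces b = 0, and n is
  constant.\<close>

lemma monomial_of_monomial_slices:
  fixes W :: "complex \<Rightarrow> complex \<Rightarrow> complex"
  assumes A: "\<And>x. x \<noteq> 0 \<Longrightarrow> \<exists>l n. l \<noteq> 0 \<and> (\<forall>z. z \<noteq> 0 \<longrightarrow> W x z = l * z powi n)"
    and B: "\<And>z. z \<noteq> 0 \<Longrightarrow> \<exists>l n. l \<noteq> 0 \<and> (\<forall>x. x \<noteq> 0 \<longrightarrow> W x z = l * x powi n)"
  shows "\<exists>l a b. l \<noteq> 0 \<and> (\<forall>x z. x \<noteq> 0 \<longrightarrow> z \<noteq> 0 \<longrightarrow> W x z = l * x powi b * z powi a)"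
proof -
  obtain l1 b1 where 1: "l1 \<noteq> 0" "\<And>x. x \<noteq> 0 \<Longrightarrow> W x 1 = l1 * x powi b1" using B[of 1] by auto
  obtain l2 b2 where 2: "l2 \<noteq> 0" "\<And>x. x \<noteq> 0 \<Longrightarrow> W x 2 = l2 * x powi b2" using B[of 2] by auto
  have "\<exists>n. \<forall>z. z \<noteq> 0 \<longrightarrow> W x z = W x 1 * z powi n" if "x \<noteq> 0" for x
    using A[OF that] by force
  then obtain n where n: "\<And>x z. x \<noteq> 0 \<Longrightarrow> z \<noteq> 0 \<Longrightarrow> W x z = W x 1 * z powi n x" by metis
  define b where "b = b2 - b1"
  have r: "l2 / l1 * x powi b = of_real (2 powi n x)" if "x \<noteq> 0" for x
  proof -
    have "l2 * x powi b2 = l1 * x powi b1 * 2 powi n x"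
      using n[of x 2] that 1 2 by simp
    then show ?thesis using that 1(1) by (simp add: b_def power_int_diff field_simps)
  qed
  have r1: "l2 / l1 = of_real (2 powi n 1)" using r[of 1] by simp
  have pos: "(2::real) powi m > 0" for m by simp
  have "b = 0"
  proof (rule ccontr)
    assume b: "b \<noteq> 0"
    \<comment> \<open>A solution of \<open>?x powi b = -1\<close>: the ratio at \<open>?x\<close>
      would be minus the ratio at 1, yet both are positive.\<close>
    let ?x = "exp (\<i> * of_real pi / of_int b)"
    have "?x powi b = -1" using b by (simp add: exp_power_int)
    then have "complex_of_real (- (2 powi n 1)) = of_real (2 powi n ?x)"
      using r[of ?x] unfolding r1 by simp
    then have "- (2 powi n 1) = (2::real) powi n ?x" by (simp only: of_real_eq_iff)
    then show False using pos[of "n 1"] pos[of "n ?x"] by linarith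
  qed
  have n1: "n x = n 1" if "x \<noteq> 0" for x
  proof -
    have "complex_of_real (2 powi n x) = of_real (2 powi n 1)" using r[OF that] r1 \<open>b = 0\<close> by simp
    then have "(2::real) powi n x = 2 powi n 1" by (simp only: of_real_eq_iff)
    then show ?thesis
      using power_int_strict_increasing[of "n x" "n 1" "2::real"]
        power_int_strict_increasing[of "n 1" "n x" "2::real"]
      by (cases "n x" "n 1" rule: linorder_cases) auto
  qed
  have "W x z = l1 * x powi b1 * z powi n 1" if "x \<noteq> 0" "z \<noteq> 0" for x z
    using n[OF that] unfolding n1[OF that(1)] 1(2)[OF that(1)] .
  then show ?thesis using 1(1) by blast
qed

text \<open>A positive exponent gives limit 0, and for a negative one the inverse has limit 0. This
  excludes a factor x^b from units that extend across x = 0.\<close>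

lemma punctured_power_limit:
  assumes lim: "((\<lambda>t. t powi b) \<longlongrightarrow> m) (at (0::complex))" and m: "m \<noteq> 0"
  shows "b = 0"
proof (rule ccontr)
  assume b: "b \<noteq> 0"
  have lim0: "((\<lambda>t. t powi n) \<longlongrightarrow> 0) (at (0::complex))" if "n > 0" for n
  proof -
    have "((\<lambda>t. t ^ nat n) \<longlongrightarrow> 0) (at (0::complex))"
      using that by (auto intro!: tendsto_eq_intros)
    then show ?thesis using that by (simp add: power_int_def)
  qed
  show False
  proof (cases "b > 0")
    case True
    have "m = 0" by (rule tendsto_unique[OF _ lim lim0[OF True]]) simp
    then show False using m by simp
  next
    case False
    have "((\<lambda>t. t powi (- b)) \<longlongrightarrow> inverse m) (at (0::complex))"
      unfolding power_int_minus using lim m by (rule tendsto_inverse)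
    moreover have "((\<lambda>t. t powi (- b)) \<longlongrightarrow> 0) (at (0::complex))" using False b by (intro lim0) auto
    ultimately have "inverse m = 0" by (intro tendsto_unique[of "at (0::complex)"]) auto
    then show False using m by simp
  qed
qed

context three_coordinates
begin

abbreviation "level k c \<equiv> {v. Q k v = c}"

text \<open>The part x \<noteq> 0 of the level set is a product of two punctured lines, with
  coordinates x and z, and an affine space of passive coordinates, so units there are monomials in x
  and z. Approaching a point with x = 0, where \<open>U\<close> is finite and nonzero, rules out the
  x-power. For c \<noteq> -1 the coordinate z has no zero, being a factor of 1 + c.\<close>

lemma units_on_level_set:
  assumes U: "regular_on (level k c) U" "\<And>v. v \<in> level k c \<Longrightarrow> U v \<noteq> 0" and c: "c \<noteq> -1"
  shows "\<exists>l a. l \<noteq> 0 \<and> (\<forall>v \<in> level k c. U v = l * (v $ iz) powi a)"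
proof -
  define Y where "Y x z = ((1 + c) / z - 1 - x * (z - 1) ^ k) / x\<^sup>2" for x z
  define \<Gamma> where "\<Gamma> s x z = upd s x (Y x z) z" for s x z
  have \<Gamma>: "\<Gamma> s x z \<in> level k c" if "x \<noteq> 0" "z \<noteq> 0" for s x z
    using that by (simp add: \<Gamma>_def Q_eq Y_def field_simps)
  have \<Gamma>_self: "\<Gamma> v (v $ ix) (v $ iz) = v" if v: "v \<in> level k c" "v $ ix \<noteq> 0" for v
  proof -
    have z: "v $ iz \<noteq> 0" using v(1) c by (auto simp: Q_eq eq_neg_iff_add_eq_0)
    have "v $ iz * (1 + v $ ix * (v $ iz - 1) ^ k + (v $ ix)\<^sup>2 * v $ iy) = 1 + c"
      using v(1) by (simp add: Q_eq algebra_simps)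
    then have "1 + v $ ix * (v $ iz - 1) ^ k + (v $ ix)\<^sup>2 * v $ iy = (1 + c) / v $ iz"
      using z by (simp add: field_simps)
    then have "Y (v $ ix) (v $ iz) = v $ iy"
      using v(2) unfolding Y_def by (simp add: field_simps)
    then show ?thesis by (simp add: \<Gamma>_def)
  qed
  have "\<exists>l a b. l \<noteq> 0 \<and> (\<forall>x z. x \<noteq> 0 \<longrightarrow> z \<noteq> 0 \<longrightarrow> U (\<Gamma> 0 x z) = l * x powi b * z powi a)"
  proof (rule monomial_of_monomial_slices)
    fix x :: complex assume x: "x \<noteq> 0"
    show "\<exists>l n. l \<noteq> 0 \<and> (\<forall>z. z \<noteq> 0 \<longrightarrow> U (\<Gamma> 0 x z) = l * z powi n)"
    \<comment> \<open>With x fixed, the solved y has denominator z; with z fixed, x^2. Hence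
      \<open>N = 1\<close> here and \<open>N = 2\<close> below.\<close>
    proof (rule regular_unit_on_punctured_line[OF U, where N = 1])
      define E where "E i = (if i = ix then [:0, x:] else if i = iz then [:0, 0, 1:]
        else if i = iy then smult (1 / x\<^sup>2) ([:1 + c, -1:] - smult x ([:0, 1:] * [:-1, 1:] ^ k)) else 0)" for i
      show "\<Gamma> 0 x t $ i = poly (E i) t / t ^ 1" if "t \<noteq> 0" for t i
        by (rule coordinate_cases[of _ i])
           (use that x distinct in \<open>auto simp: E_def \<Gamma>_def Y_def poly_power field_simps\<close>)
    qed (use x \<Gamma> in auto)
  next
    fix z :: complex assume z: "z \<noteq> 0"
    show "\<exists>l n. l \<noteq> 0 \<and> (\<forall>x. x \<noteq> 0 \<longrightarrow> U (\<Gamma> 0 x z) = l * x powi n)"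
    proof (rule regular_unit_on_punctured_line[OF U, where N = 2])
      define E where "E i = (if i = ix then [:0, 0, 0, 1:] else if i = iz then [:0, 0, z:]
        else if i = iy then [:(1 + c) / z - 1, - ((z - 1) ^ k):] else 0)" for i
      show "\<Gamma> 0 t z $ i = poly (E i) t / t ^ 2" if "t \<noteq> 0" for t i
        by (rule coordinate_cases[of _ i])
           (use that z distinct in \<open>auto simp: E_def \<Gamma>_def Y_def power2_eq_square\<close>)
    qed (use z \<Gamma> in auto)
  qed
  then obtain l a b where l: "l \<noteq> 0"
    and lab: "\<And>x z. x \<noteq> 0 \<Longrightarrow> z \<noteq> 0 \<Longrightarrow> U (\<Gamma> 0 x z) = l * x powi b * z powi a" by blast
  \<comment> \<open>The passive coordinates are contracted to 0 along a line inside the level set,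
    on which a unit is constant.\<close>
  have indep: "U (\<Gamma> s x z) = U (\<Gamma> 0 x z)" if xz: "x \<noteq> 0" "z \<noteq> 0" for s x z
  proof -
    have "U ((\<lambda>t. \<Gamma> (t *s s) x z) 1) = U ((\<lambda>t. \<Gamma> (t *s s) x z) 0)"
    proof (rule regular_unit_on_line[OF U])
      define E where "E i = (if i = ix then [:x:] else if i = iz then [:z:]
        else if i = iy then [:Y x z:] else [:0, s $ i:])" for i
      show "\<Gamma> (t *s s) x z $ i = poly (E i) t" for t i
        by (rule coordinate_cases[of _ i]) (use distinct in \<open>auto simp: E_def \<Gamma>_def\<close>)
    qed (use xz \<Gamma> in auto)
    then show ?thesis by simp
  qed
  have U1: "U v = l * (v $ ix) powi b * (v $ iz) powi a" if v: "v \<in> level k c" "v $ ix \<noteq> 0" for v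
  proof -
    have "v $ iz \<noteq> 0" using v(1) c by (auto simp: Q_eq eq_neg_iff_add_eq_0)
    then show ?thesis
      using \<Gamma>_self[OF v] lab[of "v $ ix" "v $ iz"] indep[of "v $ ix" "v $ iz" v] v(2)
      by simp
  qed
  have lim: "((\<lambda>t. l * t powi b) \<longlongrightarrow> U v / (v $ iz) powi a) (at 0)" if v: "v \<in> level k c" "v $ ix = 0" for v
  proof -
    obtain y z where yz: "(y \<longlongrightarrow> v $ iy) (at 0)" "(z \<longlongrightarrow> v $ iz) (at 0)"
        "\<forall>\<^sub>F t in at (0::complex). Q k (upd v t (y t) (z t)) = c"
      using level_set_curve v by blast
    have "((\<lambda>t. upd v t (y t) (z t)) \<longlongrightarrow> v) (at 0)"
    proof (rule vec_tendstoI)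
      show "((\<lambda>t. upd v t (y t) (z t) $ i) \<longlongrightarrow> v $ i) (at 0)" for i
        by (rule coordinate_cases[of _ i]) (use yz v in auto)
    qed
    then have "((\<lambda>t. U (upd v t (y t) (z t))) \<longlongrightarrow> U v) (at 0)"
      using yz(3) v(1) by (intro continuous_on_tendsto_compose[OF regular_on_continuous[OF U(1)]]) auto
    moreover have vz: "v $ iz \<noteq> 0" using v c by (auto simp: Q_eq eq_neg_iff_add_eq_0)
    ultimately have 1: "((\<lambda>t. U (upd v t (y t) (z t)) / z t powi a) \<longlongrightarrow> U v / (v $ iz) powi a) (at 0)"
      using yz(2) by (intro tendsto_divide tendsto_power_int) auto
    have "\<forall>\<^sub>F t in at (0::complex). t \<noteq> 0" by (simp add: eventually_at_filter)
    with yz(3) tendsto_imp_eventually_ne[OF yz(2) vz]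
    have "\<forall>\<^sub>F t in at 0. U (upd v t (y t) (z t)) / z t powi a = l * t powi b"
      by eventually_elim (simp add: U1)
    then show ?thesis by (rule Lim_transform_eventually[OF 1])
  qed
  have "b = 0"
  proof (rule punctured_power_limit)
    let ?v = "upd 0 0 0 (1 + c)"
    have v: "?v \<in> level k c" by (simp add: Q_eq)
    have "1 + c \<noteq> 0" using c by (metis add.commute add_eq_0_iff)
    then show "U ?v / (1 + c) powi a / l \<noteq> 0" using U(2)[OF v] l by simp
    show "((\<lambda>t. t powi b) \<longlongrightarrow> U ?v / (1 + c) powi a / l) (at 0)"
      using tendsto_divide[OF lim[OF v] tendsto_const[of l]] l by simp
  qed
  have "U v = l * (v $ iz) powi a" if v: "v \<in> level k c" for v
  proof (cases "v $ ix = 0")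
    case True
    have vz: "v $ iz \<noteq> 0" using v c by (auto simp: Q_eq eq_neg_iff_add_eq_0)
    have "U v / (v $ iz) powi a = l"
      using lim[OF v True] \<open>b = 0\<close> by (simp add: tendsto_const_iff)
    then show ?thesis using vz by (simp add: field_simps)
  qed (use U1 v \<open>b = 0\<close> in auto)
  then show ?thesis using l by blast
qed

section \<open>Non-isomorphic smooth hypersurfaces\<close>

text \<open>
  The unit \<open>z\<close> of \<open>HQ 1\<close> has a critical point, whereas the units of \<open>HQ 0\<close> are \<open>l z\<^sup>a\<close>, and \<open>z\<close>
  has no critical point on \<open>HQ 0\<close>.
\<close>

lemma HQ_0_not_isomorphic_HQ_1: "\<not> variety_iso (HQ 0) (HQ 1)"
proof
  assume "variety_iso (HQ 0) (HQ 1)"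
  then obtain \<phi> \<psi> where maps: "regular_map (HQ 0) (HQ 1) \<phi>" "regular_map (HQ 1) (HQ 0) \<psi>"
    and inv: "\<And>w. w \<in> HQ 1 \<Longrightarrow> \<phi> (\<psi> w) = w" unfolding variety_iso_def by blast
  have \<phi>H: "\<phi> v \<in> HQ 1" if "v \<in> HQ 0" for v using maps(1) that by (auto simp: regular_map_def)
  have \<psi>H: "\<psi> w \<in> HQ 0" if "w \<in> HQ 1" for w using maps(2) that by (auto simp: regular_map_def)
  have reg: "regular_on (HQ 0) (\<lambda>v. \<phi> v $ j)" for j using maps(1) by (auto simp: regular_map_def)
  \<comment> \<open>\<open>\<phi>\<close> pulls the unit z of \<open>HQ 1\<close> back to a unit of
    \<open>HQ 0\<close>.\<close>
  have "\<exists>l a. l \<noteq> 0 \<and> (\<forall>v \<in> level 0 0. \<phi> v $ iz = l * (v $ iz) powi a)"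
    by (rule units_on_level_set) (use reg HQ_z \<phi>H in \<open>auto simp: H_def\<close>)
  then obtain l a where l: "l \<noteq> 0" and la: "\<And>v. v \<in> HQ 0 \<Longrightarrow> \<phi> v $ iz = l * (v $ iz) powi a"
    by (auto simp: H_def)
  \<comment> \<open>Here z is critical on \<open>HQ 1\<close>: in z = 1 - z x (z - 1) - z x^2 y the
    right side has zero differential where x = 0 and z = 1.\<close>
  define p0 where "p0 = upd 0 0 0 1"
  have p0: "p0 \<in> HQ 1" by (simp add: p0_def H_def Q_eq)
  \<comment> \<open>Otherwise z would be constant on \<open>HQ 1\<close>, which has points with z =
    1 and z = 2.\<close>
  have a: "a \<noteq> 0"
  proof
    assume "a = 0"
    then have "w $ iz = l" if "w \<in> HQ 1" for w using la[OF \<psi>H[OF that]] inv[OF that] by simp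
    moreover have "upd 0 1 (- 3 / 2) 2 \<in> HQ 1" by (simp add: H_def Q_eq)
    ultimately have "p0 $ iz = l" "upd 0 1 (- 3 / 2) 2 $ iz = l" using p0 by blast+
    then show False by (simp add: p0_def)
  qed
  define q where "q = \<psi> p0"
  have q: "q \<in> HQ 0" using \<psi>H[OF p0] by (simp add: q_def)
  \<comment> \<open>On \<open>HQ 0\<close> one has 1 / z = 1 + x + x^2 y. At \<open>q\<close> its
    derivative is nonzero in the x-direction if x = 0 and in the y-direction otherwise.\<close>
  define \<alpha> \<beta> :: complex where "\<alpha> = (if q $ ix = 0 then 1 else 0)" and "\<beta> = (if q $ ix = 0 then 0 else 1)"
  define X where "X = [:q $ ix, \<alpha>:]"
  define Y where "Y = [:q $ iy, \<beta>:]"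
  define D where "D = 1 + X + X\<^sup>2 * Y"
  define \<gamma> where "\<gamma> t = upd q (poly X t) (poly Y t) (1 / poly D t)" for t
  have D: "poly D t = 1 + poly X t + (poly X t)\<^sup>2 * poly Y t" for t by (simp add: D_def)
  have D0: "q $ iz * poly D 0 = 1" using q by (simp add: D X_def Y_def H_def Q_eq)
  then have D0': "poly D 0 \<noteq> 0" by auto
  have \<gamma>0: "\<gamma> 0 = q"
  proof -
    have "1 / poly D 0 = q $ iz" using D0 D0' by (simp add: field_simps)
    then show ?thesis by (simp add: \<gamma>_def X_def Y_def)
  qed
  have \<gamma>H: "\<gamma> t \<in> HQ 0" if "poly D t \<noteq> 0" for t
    using that by (simp add: \<gamma>_def H_def Q_eq D[symmetric])
  have ev: "\<forall>\<^sub>F t in nhds 0. poly D t \<noteq> 0"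
  proof -
    have "isCont (poly D) 0" by simp
    then show ?thesis using D0'
      by (intro tendsto_imp_eventually_ne[of _ "poly D 0"]) (auto simp: continuous_at tendsto_nhds_iff)
  qed
  have "\<exists>d. ((\<lambda>t. \<phi> (\<gamma> t) $ j) has_field_derivative d) (at 0)" for j
  proof -
    define E where "E i = (if i = ix then X * D else if i = iy then Y * D else if i = iz then 1
      else smult (q $ i) D)" for i
    have "\<exists>g h. \<forall>t. poly D t \<noteq> 0 \<longrightarrow> poly h t \<noteq> 0 \<and> \<phi> (\<gamma> t) $ j = poly g t / poly h t"
    proof (rule regular_on_rational_curve[OF reg])
      show "D \<noteq> 0" using D0' by auto
      show "\<gamma> t $ i = poly (E i) t / poly D t" if "poly D t \<noteq> 0" for t i
        by (rule coordinate_cases[of _ i]) (use that distinct in \<open>auto simp: E_def \<gamma>_def\<close>)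
    qed (rule \<gamma>H)
    then obtain g h where gh: "\<And>t. poly D t \<noteq> 0 \<Longrightarrow> poly h t \<noteq> 0 \<and> \<phi> (\<gamma> t) $ j = poly g t / poly h t"
      by blast
    have "(\<lambda>t. poly g t / poly h t) field_differentiable at 0"
      using gh[OF D0'] by (intro field_differentiable_divide) (auto simp: field_differentiable_def intro: poly_DERIV)
    then obtain d where "((\<lambda>t. poly g t / poly h t) has_field_derivative d) (at 0)"
      by (auto simp: field_differentiable_def)
    moreover have "\<forall>\<^sub>F t in nhds 0. \<phi> (\<gamma> t) $ j = poly g t / poly h t"
      using ev by eventually_elim (use gh in auto)
    ultimately show ?thesis by (subst DERIV_cong_ev[OF refl _ refl]) auto
  qed
  then obtain d where d: "\<And>j. ((\<lambda>t. \<phi> (\<gamma> t) $ j) has_field_derivative d j) (at 0)" by metis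
  let ?x = "\<lambda>t. \<phi> (\<gamma> t) $ ix" and ?y = "\<lambda>t. \<phi> (\<gamma> t) $ iy" and ?z = "\<lambda>t. \<phi> (\<gamma> t) $ iz"
  have at0: "\<phi> (\<gamma> 0) = p0" using inv[OF p0] by (simp add: \<gamma>0 q_def)
  have "((\<lambda>t. 1 - ?z t * ?x t * (?z t - 1) - ?z t * (?x t)\<^sup>2 * ?y t) has_field_derivative 0) (at 0)"
    by (auto intro!: derivative_eq_intros d simp: at0 p0_def)
  moreover have "\<forall>\<^sub>F t in nhds 0. ?z t = 1 - ?z t * ?x t * (?z t - 1) - ?z t * (?x t)\<^sup>2 * ?y t"
    using ev
  proof eventually_elim
    case (elim t)
    then have "\<phi> (\<gamma> t) \<in> HQ 1" using \<gamma>H \<phi>H by blast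
    then show ?case by (simp add: H_def Q_eq algebra_simps)
  qed
  ultimately have "(?z has_field_derivative 0) (at 0)" by (subst DERIV_cong_ev[OF refl _ refl]) auto
  moreover have "\<forall>\<^sub>F t in nhds 0. ?z t = l * (1 / poly D t) powi a"
    using ev by eventually_elim (subst la[OF \<gamma>H], auto simp: \<gamma>_def)
  ultimately have "((\<lambda>t. l * (1 / poly D t) powi a) has_field_derivative 0) (at 0)"
    by (subst (asm) DERIV_cong_ev[OF refl _ refl]) auto
  moreover have "((\<lambda>t. l * (1 / poly D t) powi a) has_field_derivative
      l * (of_int a * (1 / poly D 0) powi (a - 1) * (- poly (pderiv D) 0 / (poly D 0)\<^sup>2))) (at 0)"
    using D0' by (auto intro!: derivative_eq_intros poly_DERIV simp: power2_eq_square)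
  ultimately have "l * (of_int a * (1 / poly D 0) powi (a - 1) * (- poly (pderiv D) 0 / (poly D 0)\<^sup>2)) = 0"
    using DERIV_unique by blast
  then have "poly (pderiv D) 0 = 0" using l a D0' by simp
  moreover have "poly (pderiv D) 0 \<noteq> 0"
    by (auto simp: D_def X_def Y_def \<alpha>_def \<beta>_def pderiv_add pderiv_mult pderiv_pCons power2_eq_square)
  ultimately show False by simp
qed

lemma nonisomorphic_smooth_isomorphic_complements:
  "\<exists>(H1 :: (complex ^ 'n) set) (H2 :: (complex ^ 'n) set).
     irreducible_hypersurface H1 \<and> irreducible_hypersurface H2 \<and>
     variety_iso (- H1) (- H2) \<and> smooth_hypersurface H1 \<and> smooth_hypersurface H2 \<and>
     \<not> variety_iso H1 H2"
  using irreducible_HQ smooth_HQ HQ_0_not_isomorphic_HQ_1 complements_isomorphic[of _ _ 0]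
  by (intro exI[of _ "HQ 0"] exI[of _ "HQ 1"]) (simp add: One_nat_def)

section \<open>Polynomial functions vanishing on \<open>HQ k\<close>\<close>

text \<open>By induction, \<open>q v\<close> minus its value with the i-th coordinate set to 0 is a
  multiple of that coordinate; the hypothesis kills the subtracted term.\<close>

lemma coordinate_division:
  assumes "polyfun q" "\<And>v. v $ i = 0 \<Longrightarrow> q v = 0"
  shows "\<exists>q'. polyfun q' \<and> (\<forall>v :: complex ^ 'n. q v = v $ i * q' v)"
proof -
  let ?z = "\<lambda>v :: complex ^ 'n. \<chi> j. if j = i then 0 else v $ j"
  have "\<exists>q'. polyfun q' \<and> (\<forall>v. q v - q (?z v) = v $ i * q' v)"
    using assms(1)
  proof induction
    case (const c)
    show ?case by (rule exI[of _ "\<lambda>_. 0"]) (simp add: polyfun.const)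
  next
    case (coord j)
    show ?case by (rule exI[of _ "\<lambda>_. if j = i then 1 else 0"]) (simp add: polyfun.const)
  next
    case (add F G)
    then obtain F' G' where *: "polyfun F'" "polyfun G'" "\<And>v. F v - F (?z v) = v $ i * F' v"
      "\<And>v. G v - G (?z v) = v $ i * G' v" by blast
    have "(F v + G v) - (F (?z v) + G (?z v)) = v $ i * (F' v + G' v)" for v
      unfolding distrib_left *(3,4)[symmetric] by simp
    then show ?case using polyfun.add[OF *(1,2)] by blast
  next
    case (mult F G)
    then obtain F' G' where *: "polyfun F'" "polyfun G'" "\<And>v. F v - F (?z v) = v $ i * F' v"
      "\<And>v. G v - G (?z v) = v $ i * G' v" by blast
    have "polyfun (\<lambda>v. ?z v $ j)" for j by (cases "j = i") (auto intro: polyfun.intros)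
    then have Fz: "polyfun (\<lambda>v. F (?z v))" by (rule polyfun_compose[OF mult.hyps(1)])
    have "a * b - c * d = t * (c * y + x * b)" if "a - c = t * x" "b - d = t * y" for a b c d t x y :: complex
    proof -
      have "a * b - c * d = c * (b - d) + (a - c) * b" by (simp add: algebra_simps)
      then show ?thesis unfolding that by (simp add: algebra_simps)
    qed
    from this[OF *(3) *(4)]
    have "F v * G v - F (?z v) * G (?z v) = v $ i * (F (?z v) * G' v + F' v * G v)" for v .
    moreover have "polyfun (\<lambda>v. F (?z v) * G' v + F' v * G v)"
      by (intro polyfun.add polyfun.mult Fz * mult.hyps)
    ultimately show ?case by blast
  qed
  then obtain q' where q': "polyfun q'" "\<And>v. q v - q (?z v) = v $ i * q' v" by blast
  have "q (?z v) = 0" for v by (rule assms(2)) simp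
  then show ?thesis using q' by auto
qed

text \<open>\<open>Q k\<close> is linear in y with leading coefficient z x^2, whose powers allow y
  to be eliminated. That \<open>r\<close> is free of y is expressed by invariance under
  \<open>upd\<close>.\<close>

lemma pseudo_division:
  assumes "polyfun p"
  shows "\<exists>N q r. polyfun q \<and> polyfun r \<and> (\<forall>v y. r (upd v (v $ ix) y (v $ iz)) = r v) \<and>
    (\<forall>v. (v $ iz * (v $ ix)\<^sup>2) ^ N * p v = Q k v * q v + r v)"
  using assms
proof induction
  case (const c)
  show ?case
    by (rule exI[of _ 0], rule exI[of _ "\<lambda>_. 0"], rule exI[of _ "\<lambda>_. c"]) (simp add: polyfun.const)
next
  case (coord i)
  show ?case
  proof (cases "i = iy")
    case False
    then have "upd v (v $ ix) y (v $ iz) $ i = v $ i" for v y by (simp add: upd_def)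
    then show ?thesis
      by (intro exI[of _ 0] exI[of _ "\<lambda>_. 0"] exI[of _ "\<lambda>v. v $ i"]) (simp add: polyfun.intros)
  next
    case True
    let ?B = "\<lambda>v. - ((v $ iz - 1) + v $ ix * v $ iz * (v $ iz - 1) ^ k)"
    have "polyfun ?B" by (intro polyfun_intros)
    then show ?thesis
      by (intro exI[of _ 1] exI[of _ "\<lambda>_. 1"] exI[of _ ?B])
        (simp add: polyfun.const True Q_eq algebra_simps)
  qed
next
  case (add p1 p2)
  then obtain N1 q1 r1 N2 q2 r2 where *: "polyfun q1" "polyfun r1" "polyfun q2" "polyfun r2"
    "\<And>v y. r1 (upd v (v $ ix) y (v $ iz)) = r1 v" "\<And>v y. r2 (upd v (v $ ix) y (v $ iz)) = r2 v"
    "\<And>v. (v $ iz * (v $ ix)\<^sup>2) ^ N1 * p1 v = Q k v * q1 v + r1 v"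
    "\<And>v. (v $ iz * (v $ ix)\<^sup>2) ^ N2 * p2 v = Q k v * q2 v + r2 v" by metis
  let ?A = "\<lambda>v. v $ iz * (v $ ix)\<^sup>2"
  have "?A v ^ (N1 + N2) * (p1 v + p2 v) =
    ?A v ^ N2 * (?A v ^ N1 * p1 v) + ?A v ^ N1 * (?A v ^ N2 * p2 v)" for v
    by (simp add: algebra_simps power_add)
  then have "?A v ^ (N1 + N2) * (p1 v + p2 v) = Q k v * (?A v ^ N2 * q1 v + ?A v ^ N1 * q2 v)
    + (?A v ^ N2 * r1 v + ?A v ^ N1 * r2 v)" for v
    unfolding *(7,8) by (simp add: algebra_simps)
  moreover have "polyfun (\<lambda>v. ?A v ^ N2 * q1 v + ?A v ^ N1 * q2 v)"
    "polyfun (\<lambda>v. ?A v ^ N2 * r1 v + ?A v ^ N1 * r2 v)"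
    by (intro polyfun_intros *(1-4))+
  ultimately show ?case using *(5,6)
    by (intro exI[of _ "N1 + N2"] exI[of _ "\<lambda>v. ?A v ^ N2 * q1 v + ?A v ^ N1 * q2 v"]
      exI[of _ "\<lambda>v. ?A v ^ N2 * r1 v + ?A v ^ N1 * r2 v"]) simp
next
  case (mult p1 p2)
  then obtain N1 q1 r1 N2 q2 r2 where *: "polyfun q1" "polyfun r1" "polyfun q2" "polyfun r2"
    "\<And>v y. r1 (upd v (v $ ix) y (v $ iz)) = r1 v" "\<And>v y. r2 (upd v (v $ ix) y (v $ iz)) = r2 v"
    "\<And>v. (v $ iz * (v $ ix)\<^sup>2) ^ N1 * p1 v = Q k v * q1 v + r1 v"
    "\<And>v. (v $ iz * (v $ ix)\<^sup>2) ^ N2 * p2 v = Q k v * q2 v + r2 v" by metis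
  let ?A = "\<lambda>v. v $ iz * (v $ ix)\<^sup>2"
  let ?q = "\<lambda>v. Q k v * q1 v * q2 v + q1 v * r2 v + r1 v * q2 v"
  have "?A v ^ (N1 + N2) * (p1 v * p2 v) = (?A v ^ N1 * p1 v) * (?A v ^ N2 * p2 v)" for v
    by (simp add: algebra_simps power_add)
  then have "?A v ^ (N1 + N2) * (p1 v * p2 v) = Q k v * ?q v + r1 v * r2 v" for v
    unfolding *(7,8) by (simp add: algebra_simps)
  moreover have "polyfun ?q" "polyfun (\<lambda>v. r1 v * r2 v)"
    by (intro polyfun_intros polyfun_P *(1-4))+
  ultimately show ?case using *(5,6)
    by (intro exI[of _ "N1 + N2"] exI[of _ ?q] exI[of _ "\<lambda>v. r1 v * r2 v"]) simp
qed

lemma polyfun_cancel: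
  assumes "polyfun A" "polyfun F" "polyfun G" "A a \<noteq> 0" "\<And>v. A v * F v = A v * G v"
  shows "F v = G v"
proof -
  have "(\<forall>v. A v = 0) \<or> (\<forall>v. F v - G v = 0)"
    using assms by (intro polyfun_mult_eq_0 polyfun_diff) (auto simp: algebra_simps)
  then show ?thesis using assms(4) by auto
qed

text \<open>\<open>Q k\<close> equals -1 on z = 0, so \<open>q\<close> vanishes there and a factor z
  cancels.\<close>

lemma divide_out_z:
  assumes "polyfun p" "polyfun q" "\<And>v. v $ iz ^ n * p v = Q k v * q v"
  shows "\<exists>q'. polyfun q' \<and> (\<forall>v. p v = Q k v * q' v)"
  using assms(2,3)
proof (induction n arbitrary: q)
  case (Suc n)
  have "q v = 0" if "v $ iz = 0" for v using Suc.prems(2)[of v] that by (simp add: Q_eq)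
  then obtain q' where q': "polyfun q'" "\<And>v. q v = v $ iz * q' v"
    using coordinate_division[OF Suc.prems(1)] by blast
  have "v $ iz ^ n * p v = Q k v * q' v" for v
  proof (rule polyfun_cancel[of "\<lambda>v. v $ iz" _ _ "upd 0 0 0 1"])
    show "v $ iz * (v $ iz ^ n * p v) = v $ iz * (Q k v * q' v)" for v
      using Suc.prems(2)[of v] by (simp add: q'(2) algebra_simps)
  qed (auto intro!: polyfun_intros polyfun_P assms(1) q'(1))
  then show ?case using Suc.IH q'(1) by blast
qed auto

text \<open>On x = 0 the polynomial \<open>Q k\<close> restricts to z - 1, which is nonzero; hence
  \<open>q\<close> vanishes there and a factor x cancels.\<close>

lemma divide_out_x:
  assumes "polyfun p" "polyfun q" "\<And>v. v $ ix ^ n * p v = Q k v * q v"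
  shows "\<exists>q'. polyfun q' \<and> (\<forall>v. p v = Q k v * q' v)"
  using assms(2,3)
proof (induction n arbitrary: q)
  case (Suc n)
  have "q (upd v 0 (v $ iy) (v $ iz)) = 0" for v
  \<comment> \<open>\<open>q\<close> is first composed with the projection onto x = 0, so that z - 1
    can be cancelled between polynomials on the whole space.\<close>
  proof (rule polyfun_cancel[of "\<lambda>v. v $ iz - 1" "\<lambda>v. q (upd v 0 (v $ iy) (v $ iz))" "\<lambda>_. 0" "upd 0 0 0 0"])
    show "polyfun (\<lambda>v. q (upd v 0 (v $ iy) (v $ iz)))"
    proof (rule polyfun_compose[OF Suc.prems(1)])
      show "polyfun (\<lambda>v. upd v 0 (v $ iy) (v $ iz) $ i)" for i
        by (rule coordinate_cases[of _ i]) (auto intro: polyfun.intros)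
    qed
    show "(v $ iz - 1) * q (upd v 0 (v $ iy) (v $ iz)) = (v $ iz - 1) * 0" for v
      using Suc.prems(2)[of "upd v 0 (v $ iy) (v $ iz)"] by (simp add: Q_eq)
  qed (auto intro!: polyfun_intros)
  then have "q v = 0" if "v $ ix = 0" for v using upd_same[of v] that by metis
  then obtain q' where q': "polyfun q'" "\<And>v. q v = v $ ix * q' v"
    using coordinate_division[OF Suc.prems(1)] by blast
  have "v $ ix ^ n * p v = Q k v * q' v" for v
  proof (rule polyfun_cancel[of "\<lambda>v. v $ ix" _ _ "upd 0 1 0 0"])
    show "v $ ix * (v $ ix ^ n * p v) = v $ ix * (Q k v * q' v)" for v
      using Suc.prems(2)[of v] by (simp add: q'(2) algebra_simps)
  qed (auto intro!: polyfun_intros polyfun_P assms(1) q'(1))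
  then show ?case using Suc.IH q'(1) by blast
qed auto

text \<open>An elementary Nullstellensatz for \<open>Q k\<close>: the pseudo-remainder is free of y
  and vanishes, because any other coordinates with x, z \<noteq> 0 lift to a point of
  \<open>HQ k\<close>. The factors x and z introduced by the division are then cancelled.\<close>

lemma vanishing_on_HQ_divisible:
  assumes "polyfun p" "\<And>v. v \<in> HQ k \<Longrightarrow> p v = 0"
  shows "\<exists>q. polyfun q \<and> (\<forall>v. p v = Q k v * q v)"
proof -
  let ?A = "\<lambda>v. v $ iz * (v $ ix)\<^sup>2"
  obtain N q r where qr: "polyfun q" "polyfun r" "\<And>v y. r (upd v (v $ ix) y (v $ iz)) = r v"
    "\<And>v. ?A v ^ N * p v = Q k v * q v + r v" using pseudo_division[OF assms(1)] by metis
  have "?A v * r v = 0" for v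
  proof (cases "?A v = 0")
    case False
    define y where "y = - ((v $ iz - 1) + v $ ix * v $ iz * (v $ iz - 1) ^ k) / ?A v"
    let ?w = "upd v (v $ ix) y (v $ iz)"
    have "Q k ?w = ?A v * y + ((v $ iz - 1) + v $ ix * v $ iz * (v $ iz - 1) ^ k)"
      by (simp add: Q_eq algebra_simps)
    also have "\<dots> = 0" using False by (simp add: y_def)
    finally have "?w \<in> HQ k" by (simp add: H_def)
    then have "r ?w = 0" using qr(4)[of ?w] assms(2) by (simp add: H_def)
    then show ?thesis by (simp add: qr(3))
  qed simp
  then have r: "r v = 0" for v
    using qr(2) by (intro polyfun_cancel[of ?A r "\<lambda>_. 0" "upd 0 1 0 1"]) (auto intro!: polyfun_intros)
  have "v $ ix ^ (2 * N) * (v $ iz ^ N * p v) = Q k v * q v" for v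
    using qr(4)[of v] r by (simp add: power_mult_distrib mult_ac flip: power_mult)
  then obtain q1 where q1: "polyfun q1" "\<And>v. v $ iz ^ N * p v = Q k v * q1 v"
    using divide_out_x[of "\<lambda>v. v $ iz ^ N * p v" q "2 * N" k]
      polyfun.mult[OF polyfun_power[OF polyfun.coord] assms(1)] qr(1) by blast
  then show ?thesis using divide_out_z[OF assms(1)] by blast
qed

section \<open>Isomorphic but inequivalent hypersurfaces\<close>

text \<open>Divisibility for \<open>F\<close> and for its inverse gives cofactors whose product,
  after composition with \<open>F\<close>, is 1; a nowhere vanishing polynomial is constant.\<close>

lemma automorphism_proportional:
  assumes "polynomial_map F" "polynomial_map G"
    and GF: "\<And>v. G (F v) = v" and FG: "\<And>v. F (G v) = v" and FH: "F ` HQ k = HQ l"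
  shows "\<exists>\<theta>. \<theta> \<noteq> 0 \<and> (\<forall>v. Q l (F v) = \<theta> * Q k v)"
proof -
  have pf: "polyfun (\<lambda>v. F v $ i)" "polyfun (\<lambda>v. G v $ i)" for i
    using assms(1,2) polyfun_poly_eval unfolding polynomial_map_def by (metis (no_types, lifting) ext)+
  have FQ: "polyfun (\<lambda>v. Q l (F v))" "polyfun (\<lambda>v. Q k (G v))"
    using polyfun_compose[OF polyfun_P, of F] polyfun_compose[OF polyfun_P, of G] pf by blast+
  have 1: "Q l (F v) = 0" if "v \<in> HQ k" for v
  proof -
    have "F v \<in> HQ l" using that FH by blast
    then show ?thesis by (simp add: H_def)
  qed
  have "\<exists>W. polyfun W \<and> (\<forall>v. Q l (F v) = Q k v * W v)"
    by (rule vanishing_on_HQ_divisible[OF FQ(1)]) (rule 1)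
  then obtain W where W: "polyfun W" "\<forall>v. Q l (F v) = Q k v * W v" by metis
  have 2: "Q k (G v) = 0" if "v \<in> HQ l" for v
  proof -
    have "v \<in> F ` HQ k" using that FH by simp
    then obtain w where w: "v = F w" "w \<in> HQ k" by (rule imageE)
    have "Q k (G v) = Q k w" unfolding w(1) GF ..
    then show ?thesis using w(2) by (simp add: H_def)
  qed
  have "\<exists>W'. polyfun W' \<and> (\<forall>v. Q k (G v) = Q l v * W' v)"
    by (rule vanishing_on_HQ_divisible[OF FQ(2)]) (rule 2)
  then obtain W' where W': "polyfun W'" "\<forall>v. Q k (G v) = Q l v * W' v" by metis
  have "W v * W' (F v) = 1" for v
  proof (rule polyfun_cancel[of "Q k" "\<lambda>v. W v * W' (F v)" "\<lambda>_. 1" "upd 0 0 0 0"])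
    show "Q k v * (W v * W' (F v)) = Q k v * 1" for v
      using spec[OF W'(2), of "F v"] by (simp add: GF W(2))
  qed (auto intro!: polyfun_intros polyfun_P W(1) polyfun_compose[OF W'(1)] pf simp: Q_eq)
  then have "\<And>v. W v \<noteq> 0" by (metis mult_zero_left zero_neq_one)
  then have "W v = W 0" "W 0 \<noteq> 0" for v using polyfun_nowhere_zero_const[OF W(1)] by blast+
  then show ?thesis using W(2) by (intro exI[of _ "W 0"]) (metis mult.commute)
qed

lemma level_z_nonzero: "v \<in> level k c \<Longrightarrow> c \<noteq> -1 \<Longrightarrow> v $ iz \<noteq> 0"
  by (auto simp: Q_eq)

text \<open>On the level Q 1 = c the z-coordinate of \<open>F\<close> is a unit l(c) z^a(c). The
  same for \<open>G\<close> gives a(c) = 1 or -1, and evaluation on sections of \<open>Q 1\<close>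
  shows that l is polynomial in c and a is constant.\<close>

lemma automorphism_z_coordinate:
  assumes "polynomial_map F" "polynomial_map G"
    and GF: "\<And>v. G (F v) = v" and FG: "\<And>v. F (G v) = v"
    and \<theta>: "\<theta> \<noteq> 0" "\<And>v. Q 2 (F v) = \<theta> * Q 1 v"
  shows "\<exists>\<Lambda> a. a \<noteq> 0 \<and> (\<forall>v. Q 1 v \<noteq> -1 \<longrightarrow> \<theta> * Q 1 v \<noteq> -1 \<longrightarrow>
     poly \<Lambda> (Q 1 v) \<noteq> 0 \<and> F v $ iz = poly \<Lambda> (Q 1 v) * (v $ iz) powi a)"
proof -
  have pf: "polyfun (\<lambda>v. F v $ i)" "polyfun (\<lambda>v. G v $ i)" for i
    using assms(1,2) polyfun_poly_eval unfolding polynomial_map_def by (metis (no_types, lifting) ext)+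
  \<comment> \<open>Two sections of \<open>Q 1\<close> with x = 1, along z = 1 and z = 2. Both are
    affine in c, so the z-coordinate of \<open>F\<close> on them is polynomial in c.\<close>
  define s1 s2 where "s1 c = upd 0 1 c 1" and "s2 c = upd 0 1 ((1 + c) / 2 - 2) 2" for c
  have s: "Q 1 (s1 c) = c" "Q 1 (s2 c) = c" for c by (simp_all add: s1_def s2_def Q_eq algebra_simps)
  obtain p1 where p1: "\<And>c. poly p1 c = F (s1 c) $ iz"
  proof -
    have "s1 c = (\<chi> i. (upd 0 1 0 1) $ i + c * (upd 0 0 1 0) $ i)" for c
      by (simp add: s1_def vec_eq_iff upd_def)
    then show ?thesis using polyfun_line[OF pf(1)[of iz], of "upd 0 1 0 1" "upd 0 0 1 0"] that by auto
  qed
  obtain p2 where p2: "\<And>c. poly p2 c = F (s2 c) $ iz"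
  proof -
    have "s2 c = (\<chi> i. (upd 0 1 (1 / 2 - 2) 2) $ i + c * (upd 0 0 (1 / 2) 0) $ i)" for c
      by (simp add: s2_def vec_eq_iff upd_def field_simps)
    then show ?thesis
      using polyfun_line[OF pf(1)[of iz], of "upd 0 1 (1 / 2 - 2) 2" "upd 0 0 (1 / 2) 0"] that by auto
  qed
  have slice: "\<exists>a. (a = 1 \<or> a = -1) \<and> poly p1 c \<noteq> 0 \<and> poly p2 c = poly p1 c * 2 powi a \<and>
      (\<forall>v. Q 1 v = c \<longrightarrow> F v $ iz = poly p1 c * (v $ iz) powi a)"
    if c: "c \<noteq> -1" "\<theta> * c \<noteq> -1" for c
  proof -
    have "\<exists>l a. l \<noteq> 0 \<and> (\<forall>v \<in> level 1 c. F v $ iz = l * (v $ iz) powi a)"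
      by (rule units_on_level_set)
        (use c \<theta>(2) in \<open>auto intro!: regular_on_polyfun pf simp: level_z_nonzero[of _ 2 "\<theta> * c"]\<close>)
    then obtain l a where l: "l \<noteq> 0" "\<And>v. Q 1 v = c \<Longrightarrow> F v $ iz = l * (v $ iz) powi a" by auto
    have QG: "Q 1 (G v) = c" if "Q 2 v = \<theta> * c" for v
      using \<theta>(2)[of "G v"] that \<theta>(1) by (simp add: FG)
    have "\<exists>l' a'. l' \<noteq> 0 \<and> (\<forall>v \<in> level 2 (\<theta> * c). G v $ iz = l' * (v $ iz) powi a')"
    proof (rule units_on_level_set)
      show "G v $ iz \<noteq> 0" if "v \<in> level 2 (\<theta> * c)" for v
        using that QG c by (intro level_z_nonzero[of _ 1 c]) auto
    qed (use c in \<open>auto intro!: regular_on_polyfun pf\<close>)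
    then obtain l' a' where l': "l' \<noteq> 0" "\<And>v. Q 2 v = \<theta> * c \<Longrightarrow> G v $ iz = l' * (v $ iz) powi a'" by auto
    have comp: "v $ iz = l' * (l powi a' * (v $ iz) powi (a * a'))" if "Q 1 v = c" for v
      using l'(2)[of "F v"] l(2)[OF that] \<theta>(2)[of v] that
      by (simp add: GF power_int_mult_distrib power_int_mult)
    have "1 = l' * l powi a'" using comp[OF s(1)] by (simp add: s1_def)
    moreover have "2 = l' * (l powi a' * 2 powi (a * a'))" using comp[OF s(2)] by (simp add: s2_def)
    ultimately have "complex_of_real (2 powi 1) = of_real (2 powi (a * a'))"
      by (metis mult.assoc mult_1 of_real_numeral of_real_power_int power_int_1_right)
    then have "(2::real) powi 1 = 2 powi (a * a')" by (simp only: of_real_eq_iff)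
    then have "a * a' = 1"
      using power_int_strict_increasing[of 1 "a * a'" "2::real"]
        power_int_strict_increasing[of "a * a'" 1 "2::real"]
      by (cases "1 :: int" "a * a'" rule: linorder_cases) auto
    then have "a = 1 \<or> a = -1" using zmult_eq_1_iff by blast
    moreover have "poly p1 c = l" using l(2)[OF s(1)] by (simp add: p1 s1_def)
    moreover have "poly p2 c = l * 2 powi a" using l(2)[OF s(2)] by (simp add: p2 s2_def)
    ultimately show ?thesis using l by blast
  qed
  \<comment> \<open>Levelwise p2 = 2 p1 or p1 = 2 p2. The last two factors vanish at the excluded
    levels, so the product is zero everywhere and one alternative holds identically.\<close>
  have "(p2 - smult 2 p1) * (smult 2 p2 - p1) * ([:1, 1:] * [:1, \<theta>:]) = 0"
  proof -
    have "poly ((p2 - smult 2 p1) * (smult 2 p2 - p1) * ([:1, 1:] * [:1, \<theta>:])) c = 0" for c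
    proof (cases "c = -1 \<or> \<theta> * c = -1")
      case False
      then obtain a where "a = 1 \<or> a = -1" "poly p2 c = poly p1 c * 2 powi a" using slice by blast
      then show ?thesis by (auto simp: field_simps)
    next
      case True
      then have "poly ([:1, 1:] * [:1, \<theta>:]) c = (1 + c) * (1 + \<theta> * c)" by (simp add: algebra_simps)
      also have "\<dots> = 0" using True by auto
      finally show ?thesis by (simp only: poly_mult mult_zero_right)
    qed
    then show ?thesis using poly_all_0_iff_0 by blast
  qed
  moreover have "[:1, 1:] \<noteq> (0 :: complex poly)" "[:1, \<theta>:] \<noteq> 0" by simp_all
  ultimately consider "p2 = smult 2 p1" | "smult 2 p2 = p1"
    by (metis mult_eq_0_iff eq_iff_diff_eq_0)
  then have "\<exists>a. (a = 1 \<or> a = -1) \<and> (\<forall>c. poly p2 c = poly p1 c * 2 powi a)"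
  proof cases
    case 1
    then show ?thesis by (intro exI[of _ 1]) simp
  next
    case 2
    then have "poly p2 c = poly p1 c * 2 powi (- 1)" for c by (auto simp: power_int_minus)
    then show ?thesis by blast
  qed
  then obtain a where a: "a = 1 \<or> a = -1" "\<And>c. poly p2 c = poly p1 c * 2 powi a" by blast
  have "poly p1 (Q 1 v) \<noteq> 0 \<and> F v $ iz = poly p1 (Q 1 v) * (v $ iz) powi a"
    if v: "Q 1 v \<noteq> -1" "\<theta> * Q 1 v \<noteq> -1" for v
  proof -
    obtain b where b: "b = 1 \<or> b = -1" "poly p1 (Q 1 v) \<noteq> 0"
      "poly p2 (Q 1 v) = poly p1 (Q 1 v) * 2 powi b" "F v $ iz = poly p1 (Q 1 v) * (v $ iz) powi b"
      using slice[OF v] by blast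
    then have "(2::complex) powi a = 2 powi b" using a(2)[of "Q 1 v"] by simp
    then have "a = b" using a(1) b(1) by (auto simp: power_int_minus)
    then show ?thesis using b by simp
  qed
  then show ?thesis using a(1) by (intro exI[of _ p1] exI[of _ a]) auto
qed

text \<open>
  Along the arc \<open>x = - t\<^sup>2 / 2, y = 1, z = 1 + t\<close> the differential of \<open>Q 2\<close> is a multiple of \<open>dz\<close> up
  to order \<open>t ^ 4\<close>, although \<open>Q 2\<close> has order \<open>1\<close>. An equivalence would carry it to an arc with the
  same property for \<open>Q 1\<close>, but \<open>(Q 1)\<^sup>2\<close> lies in the ideal generated by the partial derivatives of
  \<open>Q 1\<close> with respect to \<open>x\<close> and \<open>y\<close>.
\<close>

lemma HQ_1_HQ_2_inequivalent: "\<not> (\<exists>F. polynomial_automorphism F \<and> F ` HQ 1 = HQ 2)"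
proof
  assume "\<exists>F. polynomial_automorphism F \<and> F ` HQ 1 = HQ 2"
  then obtain F G where F: "polynomial_map F" and G: "polynomial_map G"
    and GF: "\<And>v. G (F v) = v" and FG: "\<And>v. F (G v) = v" and FH: "F ` HQ 1 = HQ 2"
    unfolding polynomial_automorphism_def by blast
  obtain \<theta> where \<theta>: "\<theta> \<noteq> 0" "\<And>v. Q 2 (F v) = \<theta> * Q 1 v"
    using automorphism_proportional[OF F G GF FG FH] by blast
  obtain \<Lambda> a where a: "a \<noteq> 0" and \<Lambda>: "\<And>v. Q 1 v \<noteq> -1 \<Longrightarrow> \<theta> * Q 1 v \<noteq> -1 \<Longrightarrow>
     poly \<Lambda> (Q 1 v) \<noteq> 0 \<and> F v $ iz = poly \<Lambda> (Q 1 v) * (v $ iz) powi a"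
    using automorphism_z_coordinate[OF F G GF FG \<theta>] by blast
  obtain pF where pF: "\<And>j v. F v $ j = poly_eval (pF j) v"
    using F unfolding polynomial_map_def by metis
  define dF where "dF j e v = poly_eval (partial_deriv e (pF j)) v" for j e v
  have dF: "((\<lambda>\<sigma>. F (\<gamma> \<sigma>) $ j) has_field_derivative dF j e (\<gamma> 0)) (at 0)"
    if "\<And>i. ((\<lambda>\<sigma>. \<gamma> \<sigma> $ i) has_field_derivative axis e 1 $ i) (at 0)" for \<gamma> j e
  proof -
    have "(\<Sum>i\<in>UNIV. h i * axis e (1::complex) $ i) = h e" for h :: "'n \<Rightarrow> complex"
      by (simp add: axis_def if_distrib cong: if_cong)
    then show ?thesis
      using poly_eval_curve_derivative[of \<gamma> "axis e 1" 0 "pF j"] that by (simp add: pF dF_def)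
  qed
  \<comment> \<open>With y = 1 and z = 1 + t, this x solves (z - 1)^2 + 2 x y = 0 and so kills the
    x-derivative of \<open>Q 2\<close>, while the y-derivative z x^2 has order 4.\<close>
  define arc where "arc t = upd 0 (- t\<^sup>2 / 2) 1 (1 + t)" for t
  define \<delta> where "\<delta> t = G (arc t)" for t
  have F\<delta>: "F (\<delta> t) = arc t" for t by (simp add: \<delta>_def FG)
  have Q1\<delta>: "\<theta> * Q 1 (\<delta> t) = t - (1 + t) * t ^ 4 / 4" for t
  proof -
    have "\<theta> * Q 1 (\<delta> t) = Q 2 (arc t)" using \<theta>(2)[of "\<delta> t"] by (simp add: F\<delta>)
    also have "\<dots> = t - (1 + t) * t ^ 4 / 4"
      by (simp add: arc_def Q_eq field_simps power2_eq_square power4_eq_xxxx)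
    finally show ?thesis .
  qed
  have cont: "(\<lambda>t. f (\<delta> t)) \<midarrow>0\<rightarrow> f (\<delta> 0)" if "polyfun f" for f
  proof -
    have "polyfun (\<lambda>v. G v $ i)" for i
      using G polyfun_poly_eval unfolding polynomial_map_def by (metis (no_types, lifting) ext)
    then have fG: "continuous_on UNIV (\<lambda>v. f (G v))"
      by (intro continuous_polyfun polyfun_compose[OF that])
    have "(\<lambda>t. arc t $ i) \<midarrow>0\<rightarrow> arc 0 $ i" for i
      by (rule coordinate_cases[of _ i]) (auto simp: arc_def intro!: tendsto_eq_intros)
    then have arc_lim: "arc \<midarrow>0\<rightarrow> arc 0" by (rule vec_tendstoI)
    have "isCont (\<lambda>v. f (G v)) (arc 0)"
      using fG by (simp add: continuous_on_eq_continuous_at)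
    from isCont_tendsto_compose[OF this arc_lim] show ?thesis unfolding \<delta>_def .
  qed
  define x y z where "x t = \<delta> t $ ix" and "y t = \<delta> t $ iy" and "z t = \<delta> t $ iz" for t
  have [simp]: "upd (\<delta> t) (x t) (y t) (z t) = \<delta> t" for t by (simp add: x_def y_def z_def)
  define q where "q t = Q 1 (\<delta> t)" for t
  define good where "good t \<longleftrightarrow> q t \<noteq> -1 \<and> \<theta> * q t \<noteq> -1" for t
  have q: "q t = z t * (1 + x t * (z t - 1) + (x t)\<^sup>2 * y t) - 1" for t
    by (simp add: q_def Q_eq x_def y_def z_def)
  have qlim: "q \<midarrow>0\<rightarrow> q 0" unfolding q_def by (rule cont[OF polyfun_P])
  have q0: "q 0 = 0" using Q1\<delta>[of 0] \<theta>(1) by (simp add: q_def)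
  have good0: "good 0" using q0 by (simp add: good_def)
  have zgood: "z t \<noteq> 0" if "good t" for t using that by (auto simp: good_def q)
  have ev_good: "\<forall>\<^sub>F t in at 0. good t"
  proof -
    have "\<forall>\<^sub>F t in at 0. q t \<noteq> -1" "\<forall>\<^sub>F t in at 0. \<theta> * q t \<noteq> -1"
      using q0 by (auto intro!: tendsto_imp_eventually_ne[OF qlim]
        tendsto_imp_eventually_ne[OF tendsto_mult[OF tendsto_const qlim]])
    then show ?thesis by eventually_elim (simp add: good_def)
  qed
  define qx qy qz where "qx t = 2 * z t * x t * y t + z t * (z t - 1)"
    and "qy t = z t * (x t)\<^sup>2" and "qz t = 1 + x t * (z t - 1) + (x t)\<^sup>2 * y t + z t * x t" for t
  \<comment> \<open>\<open>\<alpha>\<close> and \<open>\<beta>\<close> are the z- and y-derivatives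
    of \<open>Q 2\<close> along the arc.\<close>
  define \<alpha> where "\<alpha> t = 1 - t ^ 4 / 4 - (1 + t) * t ^ 3" for t :: complex
  define \<beta> where "\<beta> t = (1 + t) * t ^ 4 / 4" for t :: complex
  have chain: "((\<lambda>\<sigma>. Q 2 (F (\<gamma> \<sigma>))) has_field_derivative \<alpha> t * dF iz e (\<delta> t) + \<beta> t * dF iy e (\<delta> t)) (at 0)"
    if \<gamma>: "\<gamma> 0 = \<delta> t" "\<And>i. ((\<lambda>\<sigma>. \<gamma> \<sigma> $ i) has_field_derivative axis e 1 $ i) (at 0)" for \<gamma> e t
  proof -
    note d = dF[OF \<gamma>(2), unfolded \<gamma>(1)]
    have "((\<lambda>\<sigma>. Q 2 (F (\<gamma> \<sigma>))) has_field_derivative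
       dF iz e (\<delta> t) * (1 + - t\<^sup>2 / 2 * t\<^sup>2 + (- t\<^sup>2 / 2)\<^sup>2) +
       (1 + t) * (dF ix e (\<delta> t) * t\<^sup>2 + - t\<^sup>2 / 2 * (2 * t * dF iz e (\<delta> t)) +
         2 * (- t\<^sup>2 / 2) * dF ix e (\<delta> t) + (- t\<^sup>2 / 2)\<^sup>2 * dF iy e (\<delta> t))) (at 0)"
      unfolding Q_eq
      by (rule derivative_eq_intros d refl)+ (simp add: \<gamma>(1) F\<delta> arc_def algebra_simps)
    then show ?thesis
      by (rule DERIV_cong) (simp add: \<alpha>_def \<beta>_def field_simps power2_eq_square
          power3_eq_cube power4_eq_xxxx)
  qed
  have ax: "((\<lambda>\<sigma>. upd (\<delta> t) (x t + \<sigma>) (y t) (z t) $ i) has_field_derivative axis ix 1 $ i) (at 0)"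
    "((\<lambda>\<sigma>. upd (\<delta> t) (x t) (y t + \<sigma>) (z t) $ i) has_field_derivative axis iy 1 $ i) (at 0)"
    "((\<lambda>\<sigma>. upd (\<delta> t) (x t) (y t) (z t + \<sigma>) $ i) has_field_derivative axis iz 1 $ i) (at 0)" for t i
    by (rule coordinate_cases[of _ i]; use distinct in \<open>auto simp: axis_def intro!: derivative_eq_intros\<close>)+
  have dQ: "((\<lambda>\<sigma>. Q 1 (upd (\<delta> t) (x t + \<sigma>) (y t) (z t))) has_field_derivative qx t) (at 0)"
    "((\<lambda>\<sigma>. Q 1 (upd (\<delta> t) (x t) (y t + \<sigma>) (z t))) has_field_derivative qy t) (at 0)"
    "((\<lambda>\<sigma>. Q 1 (upd (\<delta> t) (x t) (y t) (z t + \<sigma>))) has_field_derivative qz t) (at 0)" for t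
    unfolding Q_eq qx_def qy_def qz_def
    by (auto intro!: derivative_eq_intros simp: algebra_simps power2_eq_square)
  have proportional: "\<theta> * d = \<alpha> t * dF iz e (\<delta> t) + \<beta> t * dF iy e (\<delta> t)"
    if "\<gamma> 0 = \<delta> t" "\<And>i. ((\<lambda>\<sigma>. \<gamma> \<sigma> $ i) has_field_derivative axis e 1 $ i) (at 0)"
      "((\<lambda>\<sigma>. Q 1 (\<gamma> \<sigma>)) has_field_derivative d) (at 0)" for \<gamma> e t d
    using DERIV_unique[OF chain[OF that(1,2)]] DERIV_cmult[OF that(3), of \<theta>] by (simp add: \<theta>(2))
  have dz: "dF iz e (\<delta> t) = poly (pderiv \<Lambda>) (q t) * d * z t powi a +
      poly \<Lambda> (q t) * (of_int a * z t powi (a - 1) * z')"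
    if \<gamma>: "\<gamma> 0 = \<delta> t" "\<And>i. ((\<lambda>\<sigma>. \<gamma> \<sigma> $ i) has_field_derivative axis e 1 $ i) (at 0)"
      "((\<lambda>\<sigma>. Q 1 (\<gamma> \<sigma>)) has_field_derivative d) (at 0)"
      "((\<lambda>\<sigma>. \<gamma> \<sigma> $ iz) has_field_derivative z') (at 0)" and t: "good t" for \<gamma> e t d z'
  proof -
    have "(\<lambda>\<sigma>. Q 1 (\<gamma> \<sigma>)) \<midarrow>0\<rightarrow> q t"
      using DERIV_isCont[OF \<gamma>(3)] by (simp add: isCont_def \<gamma>(1) q_def)
    then have lim: "((\<lambda>\<sigma>. Q 1 (\<gamma> \<sigma>)) \<longlongrightarrow> q t) (nhds 0)"
      using tendsto_nhds_iff[of "\<lambda>\<sigma>. Q 1 (\<gamma> \<sigma>)"] by (simp add: \<gamma>(1) q_def)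
    have "\<forall>\<^sub>F \<sigma> in nhds 0. Q 1 (\<gamma> \<sigma>) \<noteq> -1"
      by (rule tendsto_imp_eventually_ne[OF lim]) (use t in \<open>simp add: good_def\<close>)
    moreover have "\<forall>\<^sub>F \<sigma> in nhds 0. \<theta> * Q 1 (\<gamma> \<sigma>) \<noteq> -1"
      by (rule tendsto_imp_eventually_ne[OF tendsto_mult[OF tendsto_const lim]])
        (use t in \<open>simp add: good_def\<close>)
    ultimately have "\<forall>\<^sub>F \<sigma> in nhds 0. F (\<gamma> \<sigma>) $ iz = poly \<Lambda> (Q 1 (\<gamma> \<sigma>)) * (\<gamma> \<sigma> $ iz) powi a"
      by eventually_elim (use \<Lambda> in blast)
    then have "((\<lambda>\<sigma>. poly \<Lambda> (Q 1 (\<gamma> \<sigma>)) * (\<gamma> \<sigma> $ iz) powi a) has_field_derivative dF iz e (\<delta> t)) (at 0)"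
      using dF[OF \<gamma>(2), of iz] unfolding \<gamma>(1) by (subst (asm) DERIV_cong_ev[OF refl _ refl]) auto
    moreover have l: "((\<lambda>\<sigma>. poly \<Lambda> (Q 1 (\<gamma> \<sigma>))) has_field_derivative poly (pderiv \<Lambda>) (q t) * d) (at 0)"
      using DERIV_chain2[OF poly_DERIV \<gamma>(3)] by (simp add: \<gamma>(1) q_def)
    have p: "((\<lambda>\<sigma>. (\<gamma> \<sigma> $ iz) powi a) has_field_derivative of_int a * z t powi (a - 1) * z') (at 0)"
      using DERIV_power_int[OF \<gamma>(4), of a] zgood[OF t] by (simp add: \<gamma>(1) z_def)
    have "((\<lambda>\<sigma>. poly \<Lambda> (Q 1 (\<gamma> \<sigma>)) * (\<gamma> \<sigma> $ iz) powi a) has_field_derivative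
       poly (pderiv \<Lambda>) (q t) * d * z t powi a + poly \<Lambda> (q t) * (of_int a * z t powi (a - 1) * z')) (at 0)"
      by (rule DERIV_cong[OF DERIV_mult[OF l p]]) (simp add: \<gamma>(1) q_def z_def algebra_simps)
    ultimately show ?thesis by (rule DERIV_unique)
  qed
  \<comment> \<open>Inserting \<open>dz\<close> into \<open>proportional\<close> and collecting the
    multiples of the derivative of \<open>Q 1\<close>; in the x- and y-directions z is constant and
    only the \<open>\<beta>\<close> term remains.\<close>
  define h where "h t = \<theta> - \<alpha> t * (poly (pderiv \<Lambda>) (q t) * z t powi a)" for t
  have hx: "h t * qx t = \<beta> t * dF iy ix (\<delta> t)" if "good t" for t
  proof -
    have "dF iz ix (\<delta> t) = poly (pderiv \<Lambda>) (q t) * qx t * z t powi a +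
      poly \<Lambda> (q t) * (of_int a * z t powi (a - 1) * 0)"
      by (rule dz[OF _ ax(1) dQ(1) _ that]) auto
    with proportional[OF _ ax(1) dQ(1), of t] show ?thesis by (simp add: h_def algebra_simps)
  qed
  have hy: "h t * qy t = \<beta> t * dF iy iy (\<delta> t)" if "good t" for t
  proof -
    have "dF iz iy (\<delta> t) = poly (pderiv \<Lambda>) (q t) * qy t * z t powi a +
      poly \<Lambda> (q t) * (of_int a * z t powi (a - 1) * 0)"
      by (rule dz[OF _ ax(2) dQ(2) _ that]) auto
    with proportional[OF _ ax(2) dQ(2), of t] show ?thesis by (simp add: h_def algebra_simps)
  qed
  \<comment> \<open>At t = 0 one has \<open>\<beta>\<close> = 0 and \<open>\<alpha>\<close> = 1, so
    the z-direction equates h(0) qz(0) with the nonzero number \<Lambda> a z^(a-1).\<close>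
  have h0: "h 0 \<noteq> 0"
  proof
    assume "h 0 = 0"
    have "dF iz iz (\<delta> 0) = poly (pderiv \<Lambda>) (q 0) * qz 0 * z 0 powi a +
      poly \<Lambda> (q 0) * (of_int a * z 0 powi (a - 1) * 1)"
      by (rule dz[OF _ ax(3) dQ(3) _ good0]) (auto intro!: derivative_eq_intros)
    moreover have "\<theta> * qz 0 = \<alpha> 0 * dF iz iz (\<delta> 0) + \<beta> 0 * dF iy iz (\<delta> 0)"
      by (rule proportional[OF _ ax(3) dQ(3)]) simp
    ultimately have "h 0 * qz 0 = poly \<Lambda> (q 0) * (of_int a * z 0 powi (a - 1))"
      by (simp add: h_def \<alpha>_def \<beta>_def algebra_simps)
    moreover have "poly \<Lambda> (q 0) \<noteq> 0" using \<Lambda>[of "\<delta> 0"] good0 by (simp add: good_def q_def)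
    ultimately show False using \<open>h 0 = 0\<close> a zgood[OF good0] by simp
  qed
  \<comment> \<open>Chosen so that q = qx \<kappa> - y (2 x + qy). Since (2 x + qy)^2 = qy (2 + z
    x)^2 / z, squaring puts q^2 into the ideal of qx and qy; \<open>S\<close> collects the cofactors
    after \<open>hx\<close> and \<open>hy\<close> have replaced these.\<close>
  define \<kappa> where "\<kappa> t = 1 / z t + x t" for t
  define S where "S t = dF iy ix (\<delta> t) * \<kappa> t * (qx t * \<kappa> t - 2 * y t * (2 * x t + qy t)) +
     dF iy iy (\<delta> t) * (y t)\<^sup>2 * (2 + z t * x t)\<^sup>2 / z t" for t
  have square: "h t * (q t)\<^sup>2 = \<beta> t * S t" if "good t" for t
  proof -
    have z: "z t \<noteq> 0" using zgood[OF that] .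
    have "q t = qx t * \<kappa> t - y t * (2 * x t + qy t)"
      using z by (simp add: q qx_def qy_def \<kappa>_def field_simps power2_eq_square)
    then have "(q t)\<^sup>2 = (qx t * \<kappa> t - y t * (2 * x t + qy t))\<^sup>2" by (rule arg_cong)
    also have "\<dots> = qx t * \<kappa> t * (qx t * \<kappa> t - 2 * y t * (2 * x t + qy t)) + (y t)\<^sup>2 * (2 * x t + qy t)\<^sup>2"
      by (simp add: algebra_simps power2_eq_square)
    also have "(2 * x t + qy t)\<^sup>2 = qy t * (2 + z t * x t)\<^sup>2 / z t"
      using z by (simp add: qy_def field_simps power2_eq_square)
    finally have q2: "(q t)\<^sup>2 = qx t * \<kappa> t * (qx t * \<kappa> t - 2 * y t * (2 * x t + qy t)) +
       (y t)\<^sup>2 * (qy t * (2 + z t * x t)\<^sup>2 / z t)" .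
    have "h t * (q t)\<^sup>2 = (h t * qx t) * \<kappa> t * (qx t * \<kappa> t - 2 * y t * (2 * x t + qy t)) +
       (h t * qy t) * (y t)\<^sup>2 * (2 + z t * x t)\<^sup>2 / z t"
      unfolding q2 by (simp add: algebra_simps)
    then show ?thesis unfolding hx[OF that] hy[OF that] by (simp add: S_def algebra_simps)
  qed
  \<comment> \<open>q has order 1 and \<open>\<beta>\<close> order 4 in t, so after cancelling t^2
    the right side still tends to 0, forcing h(0) = 0.\<close>
  have ev: "\<forall>\<^sub>F t in at 0. h t * (1 - (1 + t) * t ^ 3 / 4)\<^sup>2 = \<theta>\<^sup>2 * ((1 + t) * t\<^sup>2 / 4) * S t"
  proof -
    have "\<forall>\<^sub>F t in at (0::complex). t \<noteq> 0" by (simp add: eventually_at_filter)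
    with ev_good show ?thesis
    proof eventually_elim
      case (elim t)
      have "\<theta> * q t = t * (1 - (1 + t) * t ^ 3 / 4)"
        unfolding q_def Q1\<delta> by (simp add: field_simps eval_nat_numeral)
      then have "h t * (t * (1 - (1 + t) * t ^ 3 / 4))\<^sup>2 = \<theta>\<^sup>2 * (h t * (q t)\<^sup>2)"
        by (metis mult.left_commute power_mult_distrib)
      also have "\<dots> = t\<^sup>2 * (\<theta>\<^sup>2 * ((1 + t) * t\<^sup>2 / 4) * S t)"
        unfolding square[OF elim(1)] by (simp add: \<beta>_def eval_nat_numeral)
      finally have "t\<^sup>2 * (h t * (1 - (1 + t) * t ^ 3 / 4)\<^sup>2) = t\<^sup>2 * (\<theta>\<^sup>2 * ((1 + t) * t\<^sup>2 / 4) * S t)"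
        by (simp add: power_mult_distrib mult_ac)
      then show ?case using elim(2) by (simp only: mult_cancel_left power_not_zero simp_thms)
    qed
  qed
  have lims: "x \<midarrow>0\<rightarrow> x 0" "y \<midarrow>0\<rightarrow> y 0" "z \<midarrow>0\<rightarrow> z 0"
    unfolding x_def y_def z_def by (rule cont[OF polyfun.coord])+
  have dlims: "(\<lambda>t. dF j e (\<delta> t)) \<midarrow>0\<rightarrow> dF j e (\<delta> 0)" for j e
    unfolding dF_def by (rule cont[OF polyfun_poly_eval])
  have z0: "z 0 \<noteq> 0" using zgood[OF good0] .
  have "S \<midarrow>0\<rightarrow> S 0"
    unfolding S_def \<kappa>_def qx_def qy_def by (intro tendsto_intros lims dlims z0)
  then have L1: "(\<lambda>t. \<theta>\<^sup>2 * ((1 + t) * t\<^sup>2 / 4) * S t) \<midarrow>0\<rightarrow> \<theta>\<^sup>2 * ((1 + 0) * 0\<^sup>2 / 4) * S 0"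
    by (intro tendsto_intros) auto
  have "h \<midarrow>0\<rightarrow> h 0"
    unfolding h_def \<alpha>_def using z0 by (auto intro!: tendsto_eq_intros lims(3) qlim)
  then have "(\<lambda>t. h t * (1 - (1 + t) * t ^ 3 / 4)\<^sup>2) \<midarrow>0\<rightarrow> h 0 * (1 - (1 + 0) * 0 ^ 3 / 4)\<^sup>2"
    by (intro tendsto_intros) auto
  from Lim_transform_eventually[OF this ev]
  have "h 0 * (1 - (1 + 0) * 0 ^ 3 / 4)\<^sup>2 = \<theta>\<^sup>2 * ((1 + 0) * 0\<^sup>2 / 4) * S 0"
    using L1 by (rule tendsto_unique[OF at_neq_bot])
  then show False using h0 by simp
qed

lemma isomorphic_inequivalent_isomorphic_complements:
  "\<exists>(H1 :: (complex ^ 'n) set) (H2 :: (complex ^ 'n) set).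
     irreducible_hypersurface H1 \<and> irreducible_hypersurface H2 \<and>
     variety_iso (- H1) (- H2) \<and> variety_iso H1 H2 \<and>
     \<not> (\<exists>F. polynomial_automorphism F \<and> F ` H1 = H2)"
proof (rule exI[of _ "HQ 1"], rule exI[of _ "HQ 2"], intro conjI)
  show "variety_iso (- HQ 1) (- HQ 2)"
    using complements_isomorphic[of _ _ 1] by (simp add: numeral_2_eq_2)
  show "variety_iso (HQ 1) (HQ 2)" by (rule H_isomorphic) auto
qed (rule irreducible_HQ HQ_1_HQ_2_inequivalent)+

end

theorem theorem1p1:
  assumes "CARD('n::finite) \<ge> 3"
  shows
    "(\<exists>(H1 :: (complex ^ 'n) set) (H2 :: (complex ^ 'n) set).
        irreducible_hypersurface H1 \<and> irreducible_hypersurface H2 \<and>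
        variety_iso (- H1) (- H2) \<and>
        smooth_hypersurface H1 \<and> smooth_hypersurface H2 \<and>
        \<not> variety_iso H1 H2) \<and>
     (\<exists>(H1 :: (complex ^ 'n) set) (H2 :: (complex ^ 'n) set).
        irreducible_hypersurface H1 \<and> irreducible_hypersurface H2 \<and>
        variety_iso (- H1) (- H2) \<and>
        smooth_hypersurface H1 \<and> singular_hypersurface H2) \<and>
     (\<exists>(H1 :: (complex ^ 'n) set) (H2 :: (complex ^ 'n) set).
        irreducible_hypersurface H1 \<and> irreducible_hypersurface H2 \<and>
        variety_iso (- H1) (- H2) \<and>
        variety_iso H1 H2 \<and>
        \<not> (\<exists>F. polynomial_automorphism F \<and> F ` H1 = H2))"
proof -
  \<comment> \<open>The bound on the dimension supplies three distinct indices for x, y, z; the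
    remaining coordinates are passive.\<close>
  obtain T :: "'n set" where "card T = 3" using assms obtain_subset_with_card_n by blast
  then obtain ix iy iz :: 'n where "ix \<noteq> iy" "ix \<noteq> iz" "iy \<noteq> iz" by (auto simp: card_3_iff)
  then interpret three_coordinates ix iy iz by unfold_locales
  show ?thesis
    using nonisomorphic_smooth_isomorphic_complements smooth_and_singular_isomorphic_complements
      isomorphic_inequivalent_isomorphic_complements by blast
qed

end
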